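(* Let $R>0$, $\alpha>0$, $\beta\ge 0$. Let $p:[0,+\infty)\to(0,+\infty)$ be continuous with $P:=\int_R^{+\infty}\frac{1}{p(t)}\,dt<+\infty$. Let $f:[0,+\infty)\times[0,+\infty)\to\mathbb{R}$ be continuous, with $f(t,v)\ge 0$ for $(t,v)\in[0,R]\times[0,+\infty)$ and $f(t,0)=0$ for $t\ge 0$. Suppose there are continuous functions $b_1,b_2:[R,+\infty)\to\mathbb{R}$, $b_2\ge 0$, and nondecreasing $C^1$ functions $F_1,F_2:[0,+\infty)\to[0,+\infty)$ with $F_j(0)=0$, $F_j(v)>0$ for $v>0$, $\limsup_{v\to0^+}F_j(v)/v<+\infty$ ($j=1,2$), such that $b_1(t)F_1(v)\le f(t,v)\le b_2(t)F_2(v)$ for all $(t,v)\in[R,+\infty)\times[0,+\infty)$, and such that $B_1^-:=\int_R^{+\infty}\max\{0,-b_1(t)\}\,dt<+\infty$. For $d>0$ put $M_j(d):=\sup_{v\in(0,d]}F_j(v)/v$, $j=1,2$. Let $K$, $H$, $B$ and the conditions $(\mathrm I^1_\rho)$, $(\mathrm I^0_\rho)$ be as defined in the context. (a) Suppose there exist $0<\rho_1<\rho_2<+\infty$ such that either [$(\mathrm I^0_{\rho_1})$ and $(\mathrm I^1_{\rho_2})$ hold] or [$(\mathrm I^1_{\rho_1})$ and $(\mathrm I^0_{\rho_2})$ hold]. If there exists $n>1$ such that, with $d=2\rho_2$, $$B_1^-\le\frac{\log 2}{M_1(d)P},\qquad p(t)\ge t^n\ \text{ and }\ b_2(t)\le\frac{(n-1)^2}{4M_2(d)}\,t^{n-2}\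 \text{ for all } t\ge R, \qquad (\ast)$$ then the problem $$\begin{cases}(p(t)u'(t))'+f(t,u(t))=0,\quad t\ge 0,\\ \alpha u(0)-\beta u'(0)=B[u],\quad u\ge 0\text{ and bounded on }[0,\infty),\end{cases}$$ has at least one solution $u_1$, with $u_1(t)\le 2\rho_2$ for all $t\ge 0$. (b) If, in addition, there exists $\rho_3\in(\rho_2,+\infty)$ such that either [$(\mathrm I^0_{\rho_1})$, $(\mathrm I^1_{\rho_2})$ and $(\mathrm I^0_{\rho_3})$ hold] or [$(\mathrm I^1_{\rho_1})$, $(\mathrm I^0_{\rho_2})$ and $(\mathrm I^1_{\rho_3})$ hold], and $(\ast)$ is satisfied (for some $n>1$) with $d=2\rho_3$, then the problem has an additional solution $u_2$ (distinct from $u_1$), with $u_2(t)\le 2\rho_3$ for all $t\ge0$.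
   Context: $C[0,R]$ carries the norm $\|u\|=\max_{[0,R]}|u|$. Kernel: for $t,s\in[0,R]$, $k(t,s)=\frac1\alpha\left(\frac{\beta}{p(0)}+\alpha\int_0^{\min\{s,t\}}\frac{d\mu}{p(\mu)}\right)$. Let $c(t)=\dfrac{\frac{\beta}{p(0)}+\alpha\int_0^t\frac{d\mu}{p(\mu)}}{\frac{\beta}{p(0)}+\alpha\int_0^R\frac{d\mu}{p(\mu)}}$. Fix a subinterval $[a,b]\subset[0,R]$ ($a<b$), with $a>0$ if $\beta=0$, and let $c=\min_{t\in[a,b]}c(t)$. Cone: $K=\{u\in C[0,R]: u\ge0,\ \min_{t\in[a,b]}u(t)\ge c\|u\|\}$. For $\rho>0$, $K_\rho=\{u\in K:\|u\|<\rho\}$ and $\partial K_\rho=\{u\in K:\|u\|=\rho\}$ (boundary relative to $K$). Functional: $H:K\to[0,+\infty)$ is continuous and maps bounded sets into bounded sets. $B$ has support in $[0,R]$: for $u$ on $[0,\infty)$ whose restriction to $[0,R]$ belongs to $K$, $B[u]=H[u|_{[0,R]}]$. Membership of the restriction in $K$ is part of the meaning of the boundary condition. Constants: $\frac1m=\sup_{t\in[0,R]}\int_0^Rk(t,s)\,ds$, $\frac1M=\inf_{t\in[a,b]}\int_a^bk(t,s)\,ds$. Condition $(\mathrm I^1_\rho)$: $\frac1m\overline f_\rho+\frac1\alpha\overline H_\rho<\rho$, where $\overline f_\rho=\max_{[0,R]\times[0,\rho]}f$ and $\overline H_\rho=\sup_{u\in\partial K_\rho}H[u]$. Condition $(\mathrm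 I^0_\rho)$: $\frac1M\underline f_\rho+\frac1\alpha\underline H_\rho>\rho$, where $\underline f_\rho=\min_{[a,b]\times[c\rho,\rho]}f$ and $\underline H_\rho=\inf_{u\in\partial K_\rho}H[u]$. A solution $u$ is a $C^1$ function on $[0,\infty)$ with values in $[0,\infty)$ such that $pu'$ is $C^1$, satisfying the equation pointwise and the stated conditions. *)

theory Defs
  imports "HOL-Analysis.Analysis"
begin

text \<open>
  Functions on a half-line are total functions on the reals of which only the values on the
  half-line matter. The space $C[0,R]$ is the library's metric space of continuous functions:
  its points are the continuous functions on $[0,R]$, represented as extensional functions
  (equal to \<^term>\<open>undefined\<close> outside $[0,R]$), with the supremum metric.
\<close>

definition C0R :: "real \<Rightarrow> (real \<Rightarrow> real) metric" where
  "C0R R = cfunspace (top_of_set {0..R}) euclidean_metric"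

definition supnorm :: "real \<Rightarrow> (real \<Rightarrow> real) \<Rightarrow> real" where
  "supnorm R u = (SUP t\<in>{0..R}. \<bar>u t\<bar>)"

definition kernel_k :: "real \<Rightarrow> real \<Rightarrow> (real \<Rightarrow> real) \<Rightarrow> real \<Rightarrow> real \<Rightarrow> real" where
  "kernel_k \<alpha> \<beta> p t s =
     1 / \<alpha> * (\<beta> / p 0 + \<alpha> * integral {0..min s t} (\<lambda>\<mu>. 1 / p \<mu>))"

definition c_fun :: "real \<Rightarrow> real \<Rightarrow> (real \<Rightarrow> real) \<Rightarrow> real \<Rightarrow> real \<Rightarrow> real" where
  "c_fun \<alpha> \<beta> p R t =
     (\<beta> / p 0 + \<alpha> * integral {0..t} (\<lambda>\<mu>. 1 / p \<mu>)) /
     (\<beta> / p 0 + \<alpha> * integral {0..R} (\<lambda>\<mu>. 1 / p \<mu>))"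

text \<open>
  Here and below, a maximum or minimum of a continuous function over a nonempty compact set is
  written as a supremum or infimum.
\<close>

definition c_min :: "real \<Rightarrow> real \<Rightarrow> (real \<Rightarrow> real) \<Rightarrow> real \<Rightarrow> real \<Rightarrow> real \<Rightarrow> real" where
  "c_min \<alpha> \<beta> p R a b = (INF t\<in>{a..b}. c_fun \<alpha> \<beta> p R t)"

definition cone_K ::
    "real \<Rightarrow> real \<Rightarrow> (real \<Rightarrow> real) \<Rightarrow> real \<Rightarrow> real \<Rightarrow> real \<Rightarrow> (real \<Rightarrow> real) set" where
  "cone_K \<alpha> \<beta> p R a b =
     {u \<in> mspace (C0R R). (\<forall>t\<in>{0..R}. 0 \<le> u t) \<and>
        (INF t\<in>{a..b}. u t) \<ge> c_min \<alpha> \<beta> p R a b * supnorm R u}"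

text \<open>The boundary of $K_\rho$ relative to $K$.\<close>

definition bdry_K ::
    "real \<Rightarrow> real \<Rightarrow> (real \<Rightarrow> real) \<Rightarrow> real \<Rightarrow> real \<Rightarrow> real \<Rightarrow> real \<Rightarrow> (real \<Rightarrow> real) set" where
  "bdry_K \<alpha> \<beta> p R a b \<rho> = {u \<in> cone_K \<alpha> \<beta> p R a b. supnorm R u = \<rho>}"

definition admissible_H ::
    "real \<Rightarrow> real \<Rightarrow> (real \<Rightarrow> real) \<Rightarrow> real \<Rightarrow> real \<Rightarrow> real \<Rightarrow> ((real \<Rightarrow> real) \<Rightarrow> real) \<Rightarrow> bool" where
  "admissible_H \<alpha> \<beta> p R a b H \<longleftrightarrow>
     (\<forall>u\<in>cone_K \<alpha> \<beta> p R a b. 0 \<le> H u) \<and>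
     continuous_map (subtopology (mtopology_of (C0R R)) (cone_K \<alpha> \<beta> p R a b)) euclideanreal H \<and>
     (\<forall>S \<subseteq> cone_K \<alpha> \<beta> p R a b. (\<exists>r. \<forall>u\<in>S. supnorm R u \<le> r) \<longrightarrow> bounded (H ` S))"

definition functional_B :: "real \<Rightarrow> ((real \<Rightarrow> real) \<Rightarrow> real) \<Rightarrow> (real \<Rightarrow> real) \<Rightarrow> real" where
  "functional_B R H u = H (restrict u {0..R})"

definition m_const :: "real \<Rightarrow> real \<Rightarrow> (real \<Rightarrow> real) \<Rightarrow> real \<Rightarrow> real" where
  "m_const \<alpha> \<beta> p R = 1 / (SUP t\<in>{0..R}. integral {0..R} (\<lambda>s. kernel_k \<alpha> \<beta> p t s))"

definition M_const :: "real \<Rightarrow> real \<Rightarrow> (real \<Rightarrow> real) \<Rightarrow> real \<Rightarrow> real \<Rightarrow> real" where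
  "M_const \<alpha> \<beta> p a b = 1 / (INF t\<in>{a..b}. integral {a..b} (\<lambda>s. kernel_k \<alpha> \<beta> p t s))"

definition cond_I1 ::
    "real \<Rightarrow> real \<Rightarrow> (real \<Rightarrow> real) \<Rightarrow> real \<Rightarrow> real \<Rightarrow> real \<Rightarrow>
     (real \<Rightarrow> real \<Rightarrow> real) \<Rightarrow> ((real \<Rightarrow> real) \<Rightarrow> real) \<Rightarrow> real \<Rightarrow> bool" where
  "cond_I1 \<alpha> \<beta> p R a b f H \<rho> \<longleftrightarrow>
     1 / m_const \<alpha> \<beta> p R * (SUP (t, v)\<in>{0..R} \<times> {0..\<rho>}. f t v) +
     1 / \<alpha> * (SUP u\<in>bdry_K \<alpha> \<beta> p R a b \<rho>. H u) < \<rho>"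

definition cond_I0 ::
    "real \<Rightarrow> real \<Rightarrow> (real \<Rightarrow> real) \<Rightarrow> real \<Rightarrow> real \<Rightarrow> real \<Rightarrow>
     (real \<Rightarrow> real \<Rightarrow> real) \<Rightarrow> ((real \<Rightarrow> real) \<Rightarrow> real) \<Rightarrow> real \<Rightarrow> bool" where
  "cond_I0 \<alpha> \<beta> p R a b f H \<rho> \<longleftrightarrow>
     1 / M_const \<alpha> \<beta> p a b *
       (INF (t, v)\<in>{a..b} \<times> {c_min \<alpha> \<beta> p R a b * \<rho>..\<rho>}. f t v) +
     1 / \<alpha> * (INF u\<in>bdry_K \<alpha> \<beta> p R a b \<rho>. H u) > \<rho>"

text \<open>
  \<open>g\<close> is $C^1$ on $[0,\infty)$ with derivative \<open>g'\<close>; the derivative at $0$ is one-sided.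
\<close>

definition C1_halfline :: "(real \<Rightarrow> real) \<Rightarrow> (real \<Rightarrow> real) \<Rightarrow> bool" where
  "C1_halfline g g' \<longleftrightarrow>
     (\<forall>t\<ge>0. (g has_real_derivative g' t) (at t within {0..})) \<and> continuous_on {0..} g'"

definition comparison_fun :: "(real \<Rightarrow> real) \<Rightarrow> bool" where
  "comparison_fun F \<longleftrightarrow>
     mono_on {0..} F \<and> (\<exists>F'. C1_halfline F F') \<and> (\<forall>v\<ge>0. 0 \<le> F v) \<and>
     F 0 = 0 \<and> (\<forall>v>0. 0 < F v) \<and>
     Limsup (at_right 0) (\<lambda>v. ereal (F v / v)) < \<infinity>"

definition M_sup :: "(real \<Rightarrow> real) \<Rightarrow> real \<Rightarrow> real" where
  "M_sup F d = (SUP v\<in>{0<..d}. F v / v)"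

definition P_tail :: "(real \<Rightarrow> real) \<Rightarrow> real \<Rightarrow> real" where
  "P_tail p R = integral {R..} (\<lambda>t. 1 / p t)"

definition B1_minus :: "(real \<Rightarrow> real) \<Rightarrow> real \<Rightarrow> real" where
  "B1_minus b1 R = integral {R..} (\<lambda>t. max 0 (- b1 t))"

definition cond_star ::
    "(real \<Rightarrow> real) \<Rightarrow> real \<Rightarrow> (real \<Rightarrow> real) \<Rightarrow> (real \<Rightarrow> real) \<Rightarrow>
     (real \<Rightarrow> real) \<Rightarrow> (real \<Rightarrow> real) \<Rightarrow> real \<Rightarrow> real \<Rightarrow> bool" where
  "cond_star p R b1 b2 F1 F2 n d \<longleftrightarrow>
     B1_minus b1 R \<le> ln 2 / (M_sup F1 d * P_tail p R) \<and>
     (\<forall>t\<ge>R. p t \<ge> t powr n \<and> b2 t \<le> (n - 1)\<^sup>2 / (4 * M_sup F2 d) * t powr (n - 2))"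

text \<open>In the following, \<open>u'\<close> is the derivative of \<open>u\<close>, and \<open>w\<close> that of $p u'$.\<close>

definition is_solution ::
    "real \<Rightarrow> real \<Rightarrow> (real \<Rightarrow> real) \<Rightarrow> real \<Rightarrow> real \<Rightarrow> real \<Rightarrow>
     (real \<Rightarrow> real \<Rightarrow> real) \<Rightarrow> ((real \<Rightarrow> real) \<Rightarrow> real) \<Rightarrow> (real \<Rightarrow> real) \<Rightarrow> bool" where
  "is_solution \<alpha> \<beta> p R a b f H u \<longleftrightarrow>
     (\<forall>t\<ge>0. 0 \<le> u t) \<and> bounded (u ` {0..}) \<and>
     restrict u {0..R} \<in> cone_K \<alpha> \<beta> p R a b \<and>
     (\<exists>u' w. C1_halfline u u' \<and> C1_halfline (\<lambda>t. p t * u' t) w \<and>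
        (\<forall>t\<ge>0. w t + f t (u t) = 0) \<and>
        \<alpha> * u 0 - \<beta> * u' 0 = functional_B R H u)"

end

theory Submission
  imports Defs "HOL-Complex_Analysis.Great_Picard"
begin

text \<open>
  On $[0,R]$, solutions of $(pu')'+f(t,u)=0$ satisfying the boundary condition and $u'(R)=0$ are the
  fixed points of a Hammerstein operator $T$ on the cone $K$. Condition $(\mathrm I^1_\rho)$ makes
  $T$ decrease and $(\mathrm I^0_\rho)$ makes it increase the norm on $\partial K_\rho$, so the
  compression and expansion theorems, which follow from Schauder's theorem by radial modifications
  of $T$, give fixed points whose norms lie strictly between consecutive radii. Such a fixed point
  is nondecreasing, so its norm is $u(R)$; this is what tells $u_1$ and $u_2$ apart. It is continued
  to $[R,\infty)$ as a solution of the equation with the second argument of $f$ truncated to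
  $[0,d]$. The truncation is never active: comparison with the Euler equation
  $(t^nz')'+\frac{(n-1)^2}4t^{n-2}z=0$ keeps the continuation positive, and Gronwall's inequality
  with the bound on $B_1^-$ keeps it below $2u(R)\le d$.
\<close>

section \<open>Fixed point theorems of Brouwer and Schauder\<close>

text \<open>Continuations therefore also come from a fixed point theorem and have to be chosen
  consistently with each other; truncation makes the nonlinearity bounded on compact time intervals
  and so excludes blow-up. The interval problem hands over exactly the data u(R) > 0 and u'(R) = 0.
  In the cone argument the obstacle is the origin, where radial projection is discontinuous; the
  constant function 1 is a direction along which the norm of a nonnegative function grows
  additively, and it serves to leave the origin. The constant (n-1)^2/4 is the largest kappa for
  which (t^n z')' + kappa t^(n-2) z = 0 has a real power t^mu as solution: mu^2 + (n-1) mu + kappa =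
  0 then has the double root -(n-1)/2. The number log 2 is the largest Gronwall exponent that leaves
  the growth factor at most 2. The strict inequalities in the two conditions exclude fixed points on
  the spheres themselves, so that adjacent annuli share no fixed point.\<close>

text \<open>Kuhn's lemma on a fine grid yields a cell in which, for each coordinate, the
  displacement \<open>g x - x\<close> is nonnegative at one vertex and nonpositive at another;
  uniform continuity then makes it small at the base vertex. The dimension is a number, not a type,
  because it will be the size of a finite net.\<close>

lemma brouwer_cube_approx:
  fixes g :: "(nat \<Rightarrow> real) \<Rightarrow> nat \<Rightarrow> real" and n :: nat
  assumes maps: "\<And>x i. \<forall>i<n. x i \<in> {0..1} \<Longrightarrow> i < n \<Longrightarrow> g x i \<in> {0..1}"
    and uc: "\<And>e. e > 0 \<Longrightarrow> \<exists>d>0. \<forall>x y. (\<forall>i<n. x i \<in> {0..1}) \<longrightarrow> (\<forall>i<n. y i \<in> {0..1}) \<longrightarrow>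
      (\<forall>i<n. \<bar>x i - y i\<bar> < d) \<longrightarrow> (\<forall>i<n. \<bar>g x i - g y i\<bar> < e)"
    and "e > 0"
  obtains x where "\<forall>i<n. x i \<in> {0..1}" "\<forall>i<n. \<bar>g x i - x i\<bar> < e"
proof -
  from uc[of "e/2"] \<open>e > 0\<close> obtain d where d: "d > 0"
    and uc': "\<And>x y i. \<forall>i<n. x i \<in> {0..1} \<Longrightarrow> \<forall>i<n. y i \<in> {0..1} \<Longrightarrow>
      \<forall>i<n. \<bar>x i - y i\<bar> < d \<Longrightarrow> i < n \<Longrightarrow> \<bar>g x i - g y i\<bar> < e/2"
    by (metis half_gt_zero)
  obtain p :: nat where p: "p > 0" "1 / real p < min d (e/2)"
    using \<open>d > 0\<close> \<open>e > 0\<close> real_arch_inverse[of "min d (e/2)"] by (auto simp: inverse_eq_divide)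
  define X where "X q i = real (q i) / real p" for q :: "nat \<Rightarrow> nat" and i
  \<comment> \<open>Kuhn's lemma dictates the labels on the two opposite faces. As \<open>g\<close>
    maps the cube into itself, at every grid point label 0 still means
    \<open>X q i \<le> g (X q) i\<close> and label 1 the reverse inequality.\<close>
  define label where "label q i = (if q i = 0 then 0 else if q i = p then 1
      else if X q i \<le> g (X q) i then 0 else (1::nat))" for q i
  have X_cube: "\<forall>i<n. X q i \<in> {0..1}" if "\<forall>i<n. q i \<le> p" for q
    using that p(1) by (auto simp: X_def)
  obtain q where q: "\<forall>i<n. q i < p"
    and rs: "\<forall>i<n. \<exists>r s. (\<forall>j<n. q j \<le> r j \<and> r j \<le> q j + 1) \<and>
      (\<forall>j<n. q j \<le> s j \<and> s j \<le> q j + 1) \<and> label r i \<noteq> label s i"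
    by (rule kuhn_lemma[of p n label]) (use p(1) in \<open>auto simp: label_def\<close>)
  have near: "\<forall>i<n. \<bar>X q i - X r i\<bar> < min d (e/2) \<and> X q i \<le> X r i"
      "\<forall>i<n. X r i \<in> {0..1}" if r: "\<forall>j<n. q j \<le> r j \<and> r j \<le> q j + 1" for r
  proof -
    show "\<forall>i<n. X r i \<in> {0..1}"
      using r q by (intro X_cube) (metis Suc_eq_plus1 Suc_leI le_trans)
    have "\<bar>X q i - X r i\<bar> \<le> 1 / real p \<and> X q i \<le> X r i" if "i < n" for i
    proof -
      have "real (q i) \<le> real (r i)" "real (r i) \<le> real (q i) + 1"
        using r that by (metis of_nat_le_iff, metis of_nat_le_iff of_nat_add of_nat_1)
      then show ?thesis
        using p(1) by (simp add: X_def abs_if divide_simps)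
    qed
    with p(2) show "\<forall>i<n. \<bar>X q i - X r i\<bar> < min d (e/2) \<and> X q i \<le> X r i"
      by force
  qed
  have cube: "\<forall>i<n. X q i \<in> {0..1}"
    using q by (intro X_cube) auto
  have "\<bar>g (X q) i - X q i\<bar> < e" if i: "i < n" for i
  proof -
    obtain r s where r: "\<forall>j<n. q j \<le> r j \<and> r j \<le> q j + 1"
      and s: "\<forall>j<n. q j \<le> s j \<and> s j \<le> q j + 1" and "label r i = 0" "label s i = 1"
    proof -
      obtain r s where *: "\<forall>j<n. q j \<le> r j \<and> r j \<le> q j + 1"
        "\<forall>j<n. q j \<le> s j \<and> s j \<le> q j + 1" "label r i \<noteq> label s i"
        using rs i by blast
      moreover have "label r i = 0 \<or> label r i = 1" "label s i = 0 \<or> label s i = 1"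
        by (auto simp: label_def)
      ultimately show ?thesis
        using that[of r s] that[of s r] by metis
    qed
    then have "X r i \<le> g (X r) i" "g (X s) i \<le> X s i"
      using maps[OF near(2)[OF r] i] maps[OF near(2)[OF s] i] p(1)
      by (auto simp: label_def X_def[of _ i] split: if_splits)
    moreover have "\<forall>j<n. \<bar>X q j - X r j\<bar> < d" "\<forall>j<n. \<bar>X q j - X s j\<bar> < d"
      using near(1)[OF r] near(1)[OF s] by auto
    then have "\<bar>g (X q) i - g (X r) i\<bar> < e/2" "\<bar>g (X q) i - g (X s) i\<bar> < e/2"
      using uc'[OF cube near(2)[OF r] _ i] uc'[OF cube near(2)[OF s] _ i] by blast+
    moreover have "\<bar>X q i - X r i\<bar> < e/2" "\<bar>X q i - X s i\<bar> < e/2"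
      using near(1)[OF r] near(1)[OF s] i by auto
    ultimately show ?thesis
      by linarith
  qed
  then show ?thesis
    using that cube by blast
qed

text \<open>The Schauder projection onto the hull of a finite net of \<open>C\<close> moves points
  of \<open>C\<close> by at most \<open>\<epsilon>\<close>. Composed with \<open>f\<close> and read
  in weight coordinates, it is a self-map of a cube, whose approximate fixed point is carried back
  to \<open>K\<close>.\<close>

lemma schauder_approx:
  fixes f :: "'a::real_normed_vector \<Rightarrow> 'a"
  assumes "convex K" "K \<noteq> {}" "continuous_on K f" "compact C" "C \<subseteq> K" "f ` K \<subseteq> C" "e > 0"
  obtains x where "x \<in> K" "norm (f x - x) < e"
proof -
  define \<epsilon> where "\<epsilon> = e/2"
  have "\<epsilon> > 0"
    using \<open>e > 0\<close> by (simp add: \<epsilon>_def)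
  obtain A where A: "finite A" "A \<subseteq> C" "C \<subseteq> (\<Union>x\<in>A. ball x \<epsilon>)"
    using compact_imp_seq_compact[OF \<open>compact C\<close>] seq_compact_imp_totally_bounded \<open>\<epsilon> > 0\<close> by metis
  obtain z N where "bij_betw z {0..<N::nat} A"
    using ex_bij_betw_nat_finite[OF A(1)] by blast
  then have zA: "z ` {..<N} = A"
    by (simp add: bij_betw_def lessThan_atLeast0)
  have "C \<noteq> {}"
    using assms by auto
  then have N: "N > 0"
    using A(3) zA by (metis UN_empty image_empty lessThan_0 neq0_conv subset_empty)
  \<comment> \<open>Tent functions around the points of the net; normalised by their sum they form a
    partition of unity on \<open>C\<close>.\<close>
  define w where "w i y = max 0 (\<epsilon> - dist y (z i))" for i y
  define W where "W y = (\<Sum>i<N. w i y)" for y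
  define \<phi> where "\<phi> i y = w i y / W y" for i y
  have w_nonneg: "w i y \<ge> 0" for i y
    by (simp add: w_def)
  have W_pos: "W y > 0" if y: "y \<in> C" for y
  proof -
    obtain i where "i < N" "dist y (z i) < \<epsilon>"
      using A(3) y zA by (force simp: dist_commute)
    then have "w i y > 0" "i \<in> {..<N}"
      by (auto simp: w_def)
    then show ?thesis
      unfolding W_def using w_nonneg by (intro sum_pos2[of _ i]) auto
  qed
  have \<phi>_nonneg: "\<phi> i y \<ge> 0" for i y
    by (simp add: \<phi>_def W_def w_nonneg sum_nonneg)
  have \<phi>_sum: "(\<Sum>i<N. \<phi> i y) = 1" if "y \<in> C" for y
    using W_pos[OF that] by (simp add: \<phi>_def W_def sum_divide_distrib[symmetric])
  have \<phi>_le: "\<phi> i y \<le> 1" if "y \<in> C" "i < N" for i y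
    using \<phi>_sum[OF that(1)] member_le_sum[of i "{..<N}" "\<lambda>i. \<phi> i y"] that \<phi>_nonneg by auto
  have \<phi>_cont: "continuous_on C (\<phi> i)" for i
    unfolding \<phi>_def W_def w_def
    by (intro continuous_intros) (use W_pos in \<open>force simp: W_def w_def\<close>)
  define s where "s x = (\<Sum>i<N. x i)" for x :: "nat \<Rightarrow> real"
  \<comment> \<open>Total weight above 1 is scaled back to 1, and weight missing up to 1 is left on
    \<open>z 0\<close>. Thus \<open>q\<close> is defined on the whole cube, not only on a simplex,
    and is Lipschitz.\<close>
  define m where "m x = 1 / max 1 (s x)" for x
  define v where "v x = (\<Sum>i<N. x i *\<^sub>R (z i - z 0))" for x
  define q where "q x = z 0 + m x *\<^sub>R v x" for x
  define D where "D = convex hull A"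
  have D: "compact D" "D \<subseteq> K" "convex D"
    using A assms hull_minimal[of A K convex]
    by (auto simp: D_def finite_imp_compact_convex_hull)
  have s_nonneg: "s x \<ge> 0" if "\<forall>i<N. x i \<in> {0..1}" for x
    using that by (auto simp: s_def intro!: sum_nonneg)
  have qD: "q x \<in> D" if x: "\<forall>i<N. x i \<in> {0..1}" for x
  proof -
    \<comment> \<open>The weights that exhibit \<open>q x\<close> as a convex combination of the
      net; the remainder goes to index 0.\<close>
    define c where "c i = m x * x i + (if i = 0 then 1 - m x * s x else 0)" for i
    have m1: "m x * s x \<le> 1" "m x \<ge> 0"
      using s_nonneg[OF x] by (auto simp: m_def)
    have "(\<Sum>i<N. c i) = 1"
      using N by (simp add: c_def sum.distrib sum_distrib_left[symmetric] s_def)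
    moreover have "c i \<ge> 0" if "i < N" for i
      using x that m1 by (auto simp: c_def intro!: add_nonneg_nonneg)
    moreover have "z i \<in> D" if "i < N" for i
      using zA that by (auto simp: D_def intro!: hull_inc)
    ultimately have "(\<Sum>i<N. c i *\<^sub>R z i) \<in> D"
      using D(3) by (intro convex_sum) auto
    also have "(\<Sum>i<N. c i *\<^sub>R z i) = m x *\<^sub>R (\<Sum>i<N. x i *\<^sub>R z i) + (1 - m x * s x) *\<^sub>R z 0"
      using N by (simp add: c_def scaleR_add_left sum.distrib scaleR_sum_right
          if_distrib[where f="\<lambda>c. c *\<^sub>R _"] cong: if_cong)
    also have "\<dots> = q x"
      by (simp add: q_def v_def s_def scaleR_diff_right sum_subtractf scaleR_sum_left[symmetric]
          scaleR_diff_left)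
    finally show ?thesis .
  qed
  define Z where "Z = (\<Sum>i<N. norm (z i - z 0))"
  have Z: "norm (z i - z 0) \<le> Z" if "i < N" for i
    unfolding Z_def by (intro member_le_sum) (use that in auto)
  have "Z \<ge> 0"
    by (auto simp: Z_def intro!: sum_nonneg)
  have q_lip: "norm (q x - q y) \<le> (real N * Z + real N * (real N * Z)) * d"
    if x: "\<forall>i<N. x i \<in> {0..1}" and y: "\<forall>i<N. y i \<in> {0..1}" and d: "\<forall>i<N. \<bar>x i - y i\<bar> < d"
    for x y d
  proof -
    have "d \<ge> 0"
      using d N by fastforce
    have "norm (v x - v y) \<le> (\<Sum>i<N. d * Z)"
      unfolding v_def sum_subtractf[symmetric] scaleR_diff_left[symmetric]
      by (rule sum_norm_le) (use d Z \<open>d \<ge> 0\<close> in \<open>auto intro!: mult_mono simp: less_imp_le\<close>)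
    moreover have "norm (v y) \<le> (\<Sum>i<N. 1 * Z)"
      unfolding v_def by (rule sum_norm_le) (use y Z in \<open>auto intro!: order_trans[OF mult_left_le_one_le]\<close>)
    moreover have "\<bar>m x - m y\<bar> \<le> \<bar>s x - s y\<bar>"
    proof -
      have *: "\<bar>1 / \<mu> - 1 / \<nu>\<bar> \<le> \<bar>\<mu> - \<nu>\<bar>" if "\<mu> \<ge> 1" "\<nu> \<ge> 1" for \<mu> \<nu> :: real
      proof -
        have "\<bar>1 / \<mu> - 1 / \<nu>\<bar> = \<bar>\<mu> - \<nu>\<bar> / (\<mu> * \<nu>)"
          using that by (simp add: diff_frac_eq abs_divide abs_minus_commute abs_mult)
        also have "\<dots> \<le> \<bar>\<mu> - \<nu>\<bar> / 1"
          using that mult_mono[of 1 \<mu> 1 \<nu>] by (intro divide_left_mono) auto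
        finally show ?thesis
          by simp
      qed
      have "\<bar>m x - m y\<bar> \<le> \<bar>max 1 (s x) - max 1 (s y)\<bar>"
        unfolding m_def by (rule *) auto
      then show ?thesis
        by linarith
    qed
    moreover have "\<bar>s x - s y\<bar> \<le> (\<Sum>i<N. d)"
      unfolding s_def sum_subtractf[symmetric] real_norm_def[symmetric]
      by (rule sum_norm_le) (use d in \<open>auto simp: less_imp_le\<close>)
    moreover have "\<bar>m x\<bar> \<le> 1"
      by (auto simp: m_def)
    moreover have "norm (q x - q y) \<le> \<bar>m x\<bar> * norm (v x - v y) + \<bar>m x - m y\<bar> * norm (v y)"
    proof -
      have "q x - q y = m x *\<^sub>R (v x - v y) + (m x - m y) *\<^sub>R v y"
        by (simp add: q_def algebra_simps)
      then show ?thesis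
        by (metis norm_scaleR norm_triangle_ineq)
    qed
    ultimately have "norm (q x - q y) \<le> 1 * (real N * (d * Z)) + (real N * d) * (real N * Z)"
      using \<open>d \<ge> 0\<close> \<open>Z \<ge> 0\<close>
      by (elim order_trans, intro add_mono mult_mono) auto
    then show ?thesis
      by (simp add: algebra_simps)
  qed
  define g where "g x i = \<phi> i (f (q x))" for x i
  have fq: "f (q x) \<in> C" if "\<forall>i<N. x i \<in> {0..1}" for x
    using qD[OF that] D assms by auto
  have maps: "g x i \<in> {0..1}" if "\<forall>i<N. x i \<in> {0..1}" "i < N" for x i
    using \<phi>_nonneg \<phi>_le[OF fq[OF that(1)] that(2)] by (simp add: g_def)
  have uc: "\<exists>d>0. \<forall>x y. (\<forall>i<N. x i \<in> {0..1}) \<longrightarrow> (\<forall>i<N. y i \<in> {0..1}) \<longrightarrow>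
      (\<forall>i<N. \<bar>x i - y i\<bar> < d) \<longrightarrow> (\<forall>i<N. \<bar>g x i - g y i\<bar> < \<delta>)" if "\<delta> > 0" for \<delta>
  proof -
    \<comment> \<open>Uniform continuity comes from the compact polytope \<open>D\<close> through
      which everything factors, as \<open>f\<close> is only continuous on \<open>K\<close>.\<close>
    have "uniformly_continuous_on D (\<lambda>u. \<phi> i (f u))" for i
    proof (rule compact_uniformly_continuous[OF _ D(1)])
      show "continuous_on D (\<lambda>u. \<phi> i (f u))"
        by (rule continuous_on_compose2[OF \<phi>_cont])
          (use assms D in \<open>auto intro: continuous_on_subset\<close>)
    qed
    then have "\<forall>i. \<exists>d>0. \<forall>u\<in>D. \<forall>u'\<in>D. dist u' u < d \<longrightarrow> dist (\<phi> i (f u')) (\<phi> i (f u)) < \<delta>"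
      using \<open>\<delta> > 0\<close> by (auto simp: uniformly_continuous_on_def)
    then obtain dd where dd: "\<And>i. dd i > 0"
      "\<And>i u u'. u \<in> D \<Longrightarrow> u' \<in> D \<Longrightarrow> dist u' u < dd i \<Longrightarrow> dist (\<phi> i (f u')) (\<phi> i (f u)) < \<delta>"
      by metis
    define \<eta> where "\<eta> = Min (dd ` {..<N})"
    have \<eta>: "\<eta> > 0" "\<And>i. i < N \<Longrightarrow> \<eta> \<le> dd i"
      using N dd(1) by (auto simp: \<eta>_def lessThan_empty_iff)
    \<comment> \<open>The summand 1 makes \<open>L\<close> positive even if the Lipschitz constant
      of \<open>q\<close> vanishes, and turns the weak Lipschitz estimate into a strict one.\<close>
    define L where "L = real N * Z + real N * (real N * Z) + 1"
    have "L > 0"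
      using \<open>Z \<ge> 0\<close> by (auto simp: L_def intro!: add_nonneg_pos)
    show ?thesis
    proof (intro exI[of _ "\<eta> / L"] conjI allI impI)
      show "\<eta> / L > 0"
        using \<eta> \<open>L > 0\<close> by simp
      fix x y i
      assume *: "\<forall>i<N. x i \<in> {0..1}" "\<forall>i<N. y i \<in> {0..1}" "\<forall>i<N. \<bar>x i - y i\<bar> < \<eta> / L" "i < N"
      have "norm (q x - q y) \<le> (L - 1) * (\<eta> / L)"
        using q_lip[OF *(1-3)] by (simp add: L_def)
      also have "\<dots> < L * (\<eta> / L)"
        using \<eta> \<open>L > 0\<close> by (intro mult_strict_right_mono) auto
      also have "\<dots> \<le> dd i"
        using \<eta>(2)[OF *(4)] \<open>L > 0\<close> by simp
      finally show "\<bar>g x i - g y i\<bar> < \<delta>"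
        using dd(2)[OF qD[OF *(2)] qD[OF *(1)], of i] by (simp add: g_def dist_norm)
    qed
  qed
  show ?thesis
  proof (rule ccontr)
    assume neg: "\<not> thesis"
    define \<delta> where "\<delta> = \<epsilon> / (2 * (real N * Z + real N * (real N * Z) + 1))"
    have "\<delta> > 0"
      using \<open>\<epsilon> > 0\<close> \<open>Z \<ge> 0\<close> by (auto simp: \<delta>_def intro!: divide_pos_pos add_nonneg_pos)
    then obtain x where x: "\<forall>i<N. x i \<in> {0..1}" "\<forall>i<N. \<bar>g x i - x i\<bar> < \<delta>"
      using brouwer_cube_approx[of N g \<delta>] maps uc by blast
    define y where "y = f (q x)"
    have gx: "\<forall>i<N. g x i \<in> {0..1}"
      using maps x by blast
    have yC: "y \<in> C"
      using fq x y_def by simp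
    have "norm (q (g x) - q x) \<le> (real N * Z + real N * (real N * Z)) * \<delta>"
      by (rule q_lip[OF gx x(1) x(2)])
    also have "\<dots> < \<epsilon>"
      using \<open>\<epsilon> > 0\<close> \<open>Z \<ge> 0\<close> by (simp add: \<delta>_def divide_simps add_nonneg_pos)
    finally have 1: "norm (q (g x) - q x) < \<epsilon>" .
    \<comment> \<open>Weights from the partition of unity sum to 1, so nothing is rescaled and
      \<open>q (g x)\<close> is the Schauder projection of \<open>y\<close>.\<close>
    have "s (g x) = 1"
      using \<phi>_sum[OF yC] by (simp add: s_def g_def y_def)
    then have "q (g x) = (\<Sum>i<N. \<phi> i y *\<^sub>R z i)"
      using \<phi>_sum[OF yC]
      by (simp add: q_def m_def v_def scaleR_diff_right sum_subtractf scaleR_sum_left[symmetric]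
          g_def y_def)
    then have "q (g x) - y = (\<Sum>i<N. \<phi> i y *\<^sub>R (z i - y))"
      using \<phi>_sum[OF yC] by (simp add: scaleR_diff_right sum_subtractf scaleR_sum_left[symmetric])
    \<comment> \<open>Only points of the net closer to \<open>y\<close> than
      \<open>\<epsilon>\<close> carry weight.\<close>
    also have "norm \<dots> \<le> (\<Sum>i<N. \<phi> i y * \<epsilon>)"
    proof (rule sum_norm_le)
      fix i
      show "norm (\<phi> i y *\<^sub>R (z i - y)) \<le> \<phi> i y * \<epsilon>"
      proof (cases "dist y (z i) < \<epsilon>")
        case True
        then show ?thesis
          using \<phi>_nonneg[of i y] by (auto simp: dist_norm norm_minus_commute intro!: mult_left_mono)
      qed (auto simp: \<phi>_def w_def)
    qed
    also have "\<dots> = \<epsilon>"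
      using \<phi>_sum[OF yC] by (simp add: sum_distrib_right[symmetric])
    finally have "norm (y - q x) < e"
      using 1 norm_triangle_ineq[of "y - q (g x)" "q (g x) - q x"]
      by (simp add: \<epsilon>_def norm_minus_commute)
    then show False
      using neg that[of "q x"] qD[OF x(1)] D by (auto simp: y_def)
  qed
qed

text \<open>Along a subsequence the images of approximate fixed points converge in \<open>C\<close>;
  the approximate fixed points themselves then have the same limit, and continuity concludes.
  Compactness is asked of the image only, so \<open>K\<close> may be an unbounded cone.\<close>

theorem schauder_fixed_point:
  fixes f :: "'a::real_normed_vector \<Rightarrow> 'a"
  assumes "convex K" "K \<noteq> {}" "continuous_on K f" "compact C" "C \<subseteq> K" "f ` K \<subseteq> C"
  obtains x where "x \<in> C" "f x = x"
proof -
  have "\<exists>x. x \<in> K \<and> norm (f x - x) < inverse (real (Suc n))" for n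
    using schauder_approx[OF assms, of "inverse (real (Suc n))"]
    by (metis inverse_positive_iff_positive of_nat_0_less_iff zero_less_Suc)
  then obtain x where x: "\<And>n. x n \<in> K" "\<And>n. norm (f (x n) - x n) < inverse (real (Suc n))"
    by metis
  have "f (x n) \<in> C" for n
    using x assms by blast
  then obtain l r where l: "l \<in> C" "strict_mono (r :: nat \<Rightarrow> nat)" "(\<lambda>n. f (x (r n))) \<longlonglongrightarrow> l"
    using \<open>compact C\<close>[THEN compact_imp_seq_compact, THEN seq_compactE, of "\<lambda>n. f (x n)"]
    by (auto simp: o_def)
  have "(\<lambda>n. f (x n) - x n) \<longlonglongrightarrow> 0"
    by (rule tendsto_norm_zero_cancel, rule tendsto_sandwich[OF _ _ tendsto_const LIMSEQ_inverse_real_of_nat])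
      (use x in \<open>auto intro!: always_eventually less_imp_le\<close>)
  then have "(\<lambda>n. f (x (r n)) - x (r n)) \<longlonglongrightarrow> 0"
    using LIMSEQ_subseq_LIMSEQ[OF _ l(2)] by (force simp: o_def)
  from tendsto_diff[OF l(3) this] have "(\<lambda>n. x (r n)) \<longlonglongrightarrow> l"
    by simp
  then have "(\<lambda>n. f (x (r n))) \<longlonglongrightarrow> f l"
    using assms(3) l(1) assms(5) x(1) by (intro continuous_on_tendsto_compose[OF assms(3)]) auto
  with l(3) have "f l = l"
    by (rule LIMSEQ_unique[symmetric])
  then show ?thesis
    using that l by blast
qed

section \<open>Compression and expansion of a cone\<close>

text \<open>The additive law for \<open>e\<close> holds for the constant 1 among nonnegative
  functions with the supremum norm. It allows norms to be raised by a prescribed amount,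
  continuously and inside the cone.\<close>

locale normed_cone =
  fixes K :: "'a::real_normed_vector set" and e :: 'a
  assumes convex_cone: "convex K"
    and scaleR_cone: "\<And>x c. x \<in> K \<Longrightarrow> c \<ge> 0 \<Longrightarrow> c *\<^sub>R x \<in> K"
    and unit_cone: "e \<in> K"
    and norm_add_unit: "\<And>x c. x \<in> K \<Longrightarrow> c \<ge> 0 \<Longrightarrow> norm (x + c *\<^sub>R e) = norm x + c"
begin

lemma add_cone: "x \<in> K \<Longrightarrow> y \<in> K \<Longrightarrow> x + y \<in> K"
  using scaleR_cone[of "(1/2) *\<^sub>R x + (1/2) *\<^sub>R y" 2] convexD[OF convex_cone, of x y "1/2" "1/2"]
  by (simp add: scaleR_add_right)

definition annulus :: "real \<Rightarrow> real \<Rightarrow> 'a set" where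
  "annulus r1 r2 = {x \<in> K. r1 \<le> norm x \<and> norm x \<le> r2}"

text \<open>A continuous retraction of the cone onto the annulus: radial from outside, but along
  \<open>e\<close> from inside, since radial projection would break down at the origin.\<close>

definition retr :: "real \<Rightarrow> real \<Rightarrow> 'a \<Rightarrow> 'a" where
  "retr r1 r2 x = (r2 / max r2 (norm x)) *\<^sub>R x + max 0 (r1 - norm x) *\<^sub>R e"

lemma retr:
  assumes "0 < r1" "r1 < r2" "x \<in> K"
  shows "retr r1 r2 x \<in> annulus r1 r2"
    and "norm x \<le> r1 \<Longrightarrow> norm (retr r1 r2 x) = r1"
    and "norm x \<ge> r2 \<Longrightarrow> norm (retr r1 r2 x) = r2"
    and "r1 \<le> norm x \<Longrightarrow> norm x \<le> r2 \<Longrightarrow> retr r1 r2 x = x"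
proof -
  have K: "(r2 / max r2 (norm x)) *\<^sub>R x \<in> K"
    using assms by (intro scaleR_cone) auto
  have "norm (retr r1 r2 x) = norm ((r2 / max r2 (norm x)) *\<^sub>R x) + max 0 (r1 - norm x)"
    unfolding retr_def by (rule norm_add_unit[OF K]) simp
  also have "norm ((r2 / max r2 (norm x)) *\<^sub>R x) = min r2 (norm x)"
    using assms by (auto simp: max_def min_def)
  finally have *: "norm (retr r1 r2 x) = min r2 (norm x) + max 0 (r1 - norm x)" .
  show "retr r1 r2 x \<in> annulus r1 r2"
    using * assms K by (auto simp: annulus_def retr_def intro!: add_cone scaleR_cone unit_cone)
  show "norm x \<le> r1 \<Longrightarrow> norm (retr r1 r2 x) = r1" "norm x \<ge> r2 \<Longrightarrow> norm (retr r1 r2 x) = r2"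
    using * assms by auto
  show "r1 \<le> norm x \<Longrightarrow> norm x \<le> r2 \<Longrightarrow> retr r1 r2 x = x"
    using assms by (auto simp: retr_def)
qed

text \<open>Schauder's theorem applies to \<open>T\<close> after \<open>retr\<close>. A fixed point
  of norm at most \<open>r1\<close> would be the image of a point of the inner sphere and so have
  norm above \<open>r1\<close>; the outer sphere is excluded likewise. Strictly between the spheres
  \<open>retr\<close> is the identity.\<close>

theorem cone_compression:
  assumes r: "0 < r1" "r1 < r2"
    and cont: "continuous_on (annulus r1 r2) T"
    and C: "compact C" "C \<subseteq> K" "T ` annulus r1 r2 \<subseteq> C"
    and inner: "\<And>x. x \<in> K \<Longrightarrow> norm x = r1 \<Longrightarrow> norm (T x) > r1"
    and outer: "\<And>x. x \<in> K \<Longrightarrow> norm x = r2 \<Longrightarrow> norm (T x) < r2"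
  obtains x where "x \<in> K" "r1 < norm x" "norm x < r2" "T x = x"
proof -
  have retr_K: "retr r1 r2 x \<in> K" if "x \<in> K" for x
    using retr(1)[OF r that] by (simp add: annulus_def)
  have "continuous_on K (retr r1 r2)"
    unfolding retr_def by (intro continuous_intros) (use r in auto)
  then have "continuous_on K (\<lambda>x. T (retr r1 r2 x))"
    by (intro continuous_on_compose2[OF cont]) (use retr(1)[OF r] in auto)
  moreover have "(\<lambda>x. T (retr r1 r2 x)) ` K \<subseteq> C"
    using C(3) retr(1)[OF r] by auto
  ultimately obtain x where x: "x \<in> C" "T (retr r1 r2 x) = x"
    using schauder_fixed_point[OF convex_cone _ _ C(1,2), of "\<lambda>x. T (retr r1 r2 x)"] unit_cone
    by blast
  have "x \<in> K"
    using x C by auto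
  have "r1 < norm x"
    using inner[OF retr_K[OF \<open>x \<in> K\<close>] retr(2)[OF r \<open>x \<in> K\<close>]] x(2) by force
  moreover have "norm x < r2"
    using outer[OF retr_K[OF \<open>x \<in> K\<close>] retr(3)[OF r \<open>x \<in> K\<close>]] x(2) by force
  ultimately show ?thesis
    using that[of x] x(2) retr(4)[OF r \<open>x \<in> K\<close>] \<open>x \<in> K\<close> by simp
qed

text \<open>
  An expansive operator is turned into a compressive one with the same fixed points: where the
  norm of \<open>T x\<close> is too small it is reflected about the norm of \<open>x\<close> by adding a multiple of \<open>e\<close>,
  where it is too large it is inverted by rescaling.
\<close>

theorem cone_expansion:
  assumes r: "0 < r1" "r1 < r2"
    and cont: "continuous_on (annulus r1 r2) T"
    and C: "compact C" "C \<subseteq> K" "T ` annulus r1 r2 \<subseteq> C"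
    and inner: "\<And>x. x \<in> K \<Longrightarrow> norm x = r1 \<Longrightarrow> norm (T x) < r1"
    and outer: "\<And>x. x \<in> K \<Longrightarrow> norm x = r2 \<Longrightarrow> norm (T x) > r2"
  obtains x where "x \<in> K" "r1 < norm x" "norm x < r2" "T x = x"
proof -
  \<comment> \<open>Without the square, \<open>S x\<close> would have the norm of \<open>x\<close>
    wherever \<open>T\<close> increases the norm; the square gives
    \<open>(norm x)\<^sup>2 / norm (T x)\<close>, which is strictly smaller. The factor 2 in
    \<open>\<kappa>\<close> gives \<open>2 * norm x - norm (T x)\<close> where \<open>T\<close>
    decreases it.\<close>
  define \<theta> where "\<theta> x = (norm x / max (norm x) (norm (T x)))\<^sup>2" for x
  define \<kappa> where "\<kappa> x = 2 * max 0 (norm x - norm (T x))" for x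
  define S where "S x = \<theta> x *\<^sub>R T x + \<kappa> x *\<^sub>R e" for x
  define C' where "C' = (\<lambda>(s, t, y). s *\<^sub>R y + t *\<^sub>R e) ` ({0..1} \<times> {0..2 * r2} \<times> C)"
  have TK: "T x \<in> K" if "x \<in> annulus r1 r2" for x
    using that C by auto
  have norm_S: "norm (S x) = \<theta> x * norm (T x) + \<kappa> x" if x: "x \<in> annulus r1 r2" for x
    unfolding S_def by (subst norm_add_unit) (auto simp: \<theta>_def \<kappa>_def scaleR_cone TK x)
  have S_less: "norm (S x) < norm x" if x: "x \<in> annulus r1 r2" and "norm (T x) > norm x" for x
  proof -
    have "norm (S x) = norm x * (norm x / norm (T x))"
      using norm_S[OF x] that by (simp add: \<theta>_def \<kappa>_def power2_eq_square)
    also have "\<dots> < norm x * 1"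
      using that r by (intro mult_strict_left_mono) (auto simp: annulus_def divide_simps)
    finally show ?thesis
      by simp
  qed
  have S_greater: "norm (S x) > norm x" if x: "x \<in> annulus r1 r2" and "norm (T x) < norm x" for x
    using norm_S[OF x] that r by (auto simp: \<theta>_def \<kappa>_def annulus_def)
  have C': "compact C'" "C' \<subseteq> K"
  proof -
    show "compact C'"
      unfolding C'_def case_prod_beta
      by (intro compact_continuous_image continuous_intros compact_Times compact_Icc C(1))
    show "C' \<subseteq> K"
      using C(2) by (auto simp: C'_def intro!: add_cone scaleR_cone unit_cone)
  qed
  have S_C': "S ` annulus r1 r2 \<subseteq> C'"
  proof safe
    fix x assume x: "x \<in> annulus r1 r2"
    have "\<theta> x \<in> {0..1}"
      using x r by (auto simp: \<theta>_def annulus_def intro!: power_le_one)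
    moreover have "\<kappa> x \<in> {0..2 * r2}"
      using x r norm_ge_zero[of "T x"] by (simp add: \<kappa>_def annulus_def del: norm_ge_zero)
    ultimately show "S x \<in> C'"
      using C(3) x unfolding S_def C'_def by (intro image_eqI[of _ _ "(\<theta> x, \<kappa> x, T x)"]) auto
  qed
  have cont_S: "continuous_on (annulus r1 r2) S"
    unfolding S_def \<theta>_def \<kappa>_def
    by (intro continuous_intros cont) (use r in \<open>auto simp: annulus_def max_def\<close>)
  obtain x where x: "x \<in> K" "r1 < norm x" "norm x < r2" "S x = x"
  proof (rule cone_compression[OF r cont_S C' S_C'])
    show "norm (S x) > r1" if "x \<in> K" "norm x = r1" for x
      using S_greater[of x] inner[of x] that r by (simp add: annulus_def)
    show "norm (S x) < r2" if "x \<in> K" "norm x = r2" for x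
      using S_less[of x] outer[of x] that r by (simp add: annulus_def)
  qed
  then have "x \<in> annulus r1 r2"
    by (simp add: annulus_def)
  \<comment> \<open>\<open>S\<close> reverses every strict inequality between the norms of
    \<open>x\<close> and \<open>T x\<close>, so a fixed point of \<open>S\<close> admits none; then
    \<open>\<theta> x = 1\<close> and \<open>\<kappa> x = 0\<close>.\<close>
  then have "norm (T x) = norm x"
    using S_less[of x] S_greater[of x] x(4) by force
  then have "S x = T x"
    using x(2) r by (auto simp: S_def \<theta>_def \<kappa>_def)
  then show ?thesis
    using that x by simp
qed

end

section \<open>Spaces of continuous functions on an interval\<close>

text \<open>Constant extension embeds the continuous functions on an interval isometrically into the
  bounded continuous functions on the line, a type with the structure of a normed vector
  space.\<close>

definition clamp_ext :: "real \<Rightarrow> real \<Rightarrow> (real \<Rightarrow> real) \<Rightarrow> real \<Rightarrow>\<^sub>C real" where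
  "clamp_ext l r g = Bcontfun (\<lambda>t. g (max l (min r t)))"

lemma clamp_ext_apply:
  assumes "l \<le> r" "continuous_on {l..r} g"
  shows "apply_bcontfun (clamp_ext l r g) t = g (max l (min r t))"
proof -
  have "continuous_on UNIV (\<lambda>t. g (max l (min r t)))"
    by (rule continuous_on_compose2[OF assms(2)]) (use assms(1) in \<open>auto intro!: continuous_intros\<close>)
  moreover have "bounded (range (\<lambda>t. g (max l (min r t))))"
    using compact_imp_bounded[OF compact_continuous_image[OF assms(2) compact_Icc]] assms(1)
    by (rule_tac bounded_subset) auto
  ultimately show ?thesis
    unfolding clamp_ext_def by (subst Bcontfun_inverse) (auto simp: bcontfun_def)
qed

definition lipschitz_fns :: "real \<Rightarrow> real \<Rightarrow> real \<Rightarrow> real \<Rightarrow> (real \<Rightarrow>\<^sub>C real) set" where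
  "lipschitz_fns l r Q L = {v. (\<forall>t. apply_bcontfun v t = apply_bcontfun v (max l (min r t))) \<and>
     (\<forall>t. \<bar>apply_bcontfun v t\<bar> \<le> Q) \<and>
     (\<forall>s t. \<bar>apply_bcontfun v s - apply_bcontfun v t\<bar> \<le> L * \<bar>s - t\<bar>)}"

lemma clamp_ext_in_lipschitz_fns:
  assumes "l \<le> r" "L \<ge> 0" "\<And>t. t \<in> {l..r} \<Longrightarrow> \<bar>g t\<bar> \<le> Q"
    and lip: "\<And>s t. s \<in> {l..r} \<Longrightarrow> t \<in> {l..r} \<Longrightarrow> \<bar>g s - g t\<bar> \<le> L * \<bar>s - t\<bar>"
  shows "clamp_ext l r g \<in> lipschitz_fns l r Q L"
proof -
  have "L-lipschitz_on {l..r} g"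
    using lip \<open>L \<ge> 0\<close> by (auto simp: lipschitz_on_def dist_real_def)
  then have *: "apply_bcontfun (clamp_ext l r g) t = g (max l (min r t))" for t
    by (intro clamp_ext_apply assms lipschitz_on_continuous_on)
  have "\<bar>g (max l (min r s)) - g (max l (min r t))\<bar> \<le> L * \<bar>s - t\<bar>" for s t
  proof -
    have "\<bar>g (max l (min r s)) - g (max l (min r t))\<bar> \<le> L * \<bar>max l (min r s) - max l (min r t)\<bar>"
      using \<open>l \<le> r\<close> by (intro lip) auto
    also have "\<dots> \<le> L * \<bar>s - t\<bar>"
      using \<open>L \<ge> 0\<close> by (intro mult_left_mono) auto
    finally show ?thesis .
  qed
  then show ?thesis
    using assms(1,3) by (auto simp: lipschitz_fns_def * max_def min_def)
qed

text \<open>Arzela-Ascoli on the interval. Since members are constant on either side of it, uniform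
  convergence there is norm convergence, and all three defining conditions survive pointwise
  limits.\<close>

lemma compact_lipschitz_fns:
  assumes "l \<le> r" "L \<ge> 0"
  shows "compact (lipschitz_fns l r Q L)"
  unfolding compact_eq_seq_compact_metric
proof (rule seq_compactI)
  fix F assume "\<forall>n::nat. F n \<in> lipschitz_fns l r Q L"
  then have F: "\<And>n t. apply_bcontfun (F n) t = apply_bcontfun (F n) (max l (min r t))"
    "\<And>n t. \<bar>apply_bcontfun (F n) t\<bar> \<le> Q"
    "\<And>n s t. \<bar>apply_bcontfun (F n) s - apply_bcontfun (F n) t\<bar> \<le> L * \<bar>s - t\<bar>"
    by (auto simp: lipschitz_fns_def)
  obtain g k where g: "continuous_on {l..r} g" "strict_mono (k :: nat \<Rightarrow> nat)"
    and lim: "\<And>e. 0 < e \<Longrightarrow>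
      \<exists>N. \<forall>n x. n \<ge> N \<and> x \<in> {l..r} \<longrightarrow> norm (apply_bcontfun (F (k n)) x - g x) < e"
  proof (rule Arzela_Ascoli[of "{l..r}" "\<lambda>n. apply_bcontfun (F n)" Q])
    fix x e :: real assume "0 < e"
    have "L * \<bar>x - y\<bar> < e" if "\<bar>x - y\<bar> < e / (L + 1)" for y
    proof -
      have "L * \<bar>x - y\<bar> \<le> (L + 1) * \<bar>x - y\<bar>"
        by (intro mult_right_mono) auto
      also have "\<dots> < e"
        using that \<open>L \<ge> 0\<close> by (simp add: pos_less_divide_eq mult.commute)
      finally show ?thesis .
    qed
    then show "\<exists>d>0. \<forall>n y. y \<in> {l..r} \<and> norm (x - y) < d \<longrightarrow>
        norm (apply_bcontfun (F n) x - apply_bcontfun (F n) y) < e"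
      using \<open>0 < e\<close> \<open>L \<ge> 0\<close>
      by (intro exI[of _ "e / (L + 1)"]) (auto intro: le_less_trans[OF F(3)])
  qed (use F in auto)
  define G where "G = clamp_ext l r g"
  have G: "apply_bcontfun G t = g (max l (min r t))" for t
    unfolding G_def by (rule clamp_ext_apply[OF assms(1) g(1)])
  have "(\<lambda>n. F (k n)) \<longlonglongrightarrow> G"
  proof (rule metric_LIMSEQ_I)
    fix e :: real assume "e > 0"
    then obtain N where N: "\<And>n x. n \<ge> N \<Longrightarrow> x \<in> {l..r} \<Longrightarrow> norm (apply_bcontfun (F (k n)) x - g x) < e/2"
      using lim[of "e/2"] by auto
    have "dist (F (k n)) G \<le> e/2" if "n \<ge> N" for n
    proof (rule dist_bound)
      fix x
      have "max l (min r x) \<in> {l..r}"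
        using assms by auto
      from N[OF that this] show "dist (apply_bcontfun (F (k n)) x) (apply_bcontfun G x) \<le> e/2"
        by (subst F(1)) (simp add: G dist_norm)
    qed
    then show "\<exists>N. \<forall>n\<ge>N. dist (F (k n)) G < e"
      using \<open>e > 0\<close> by (intro exI[of _ N]) force
  qed
  then have lim_t: "(\<lambda>n. apply_bcontfun (F (k n)) t) \<longlonglongrightarrow> apply_bcontfun G t" for t
    using tendsto_uniform_limitI[OF tendsto_bcontfun_uniform_limit] by blast
  have "\<bar>apply_bcontfun G t\<bar> \<le> Q" for t
    by (rule LIMSEQ_le_const2[OF tendsto_rabs[OF lim_t]]) (use F in auto)
  moreover have "\<bar>apply_bcontfun G s - apply_bcontfun G t\<bar> \<le> L * \<bar>s - t\<bar>" for s t
    by (rule LIMSEQ_le_const2[OF tendsto_rabs[OF tendsto_diff[OF lim_t lim_t]]]) (use F in auto)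
  moreover have "apply_bcontfun G t = apply_bcontfun G (max l (min r t))" for t
    using assms by (auto simp: G max_def min_def)
  ultimately have "G \<in> lipschitz_fns l r Q L"
    by (simp add: lipschitz_fns_def)
  then show "\<exists>l\<in>lipschitz_fns l r Q L. \<exists>r. strict_mono r \<and> (F \<circ> r) \<longlonglongrightarrow> l"
    using \<open>(\<lambda>n. F (k n)) \<longlonglongrightarrow> G\<close> g(2) by (auto simp: o_def)
qed

text \<open>Functions within distance 1 of \<open>v\<close> keep their graphs over the interval in
  one compact rectangle, on which \<open>g\<close> is uniformly continuous.\<close>

lemma superposition_continuous:
  fixes g :: "real \<Rightarrow> real \<Rightarrow> real" and v :: "real \<Rightarrow>\<^sub>C real"
  assumes "continuous_on ({l..r} \<times> UNIV) (\<lambda>(t, x). g t x)" "\<eta> > 0"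
  obtains \<delta> where "\<delta> > 0" "\<And>w s. dist w v < \<delta> \<Longrightarrow> s \<in> {l..r} \<Longrightarrow>
    \<bar>g s (apply_bcontfun w s) - g s (apply_bcontfun v s)\<bar> < \<eta>"
proof -
  define D where "D = {l..r} \<times> {- norm v - 1..norm v + 1}"
  have "uniformly_continuous_on D (\<lambda>(t, x). g t x)"
    using assms(1) unfolding D_def
    by (intro compact_uniformly_continuous compact_Times) (auto elim: continuous_on_subset)
  then obtain d where d: "d > 0" "\<And>y y'. y \<in> D \<Longrightarrow> y' \<in> D \<Longrightarrow> dist y' y < d \<Longrightarrow>
      dist (case y' of (t, x) \<Rightarrow> g t x) (case y of (t, x) \<Rightarrow> g t x) < \<eta>"
    using \<open>\<eta> > 0\<close> unfolding uniformly_continuous_on_def by metis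
  show ?thesis
  proof (rule that[of "min d 1"])
    show "min d 1 > 0"
      using d by simp
    fix w s assume w: "dist w v < min d 1" and s: "s \<in> {l..r}"
    have vs: "\<bar>apply_bcontfun v s\<bar> \<le> norm v"
      using norm_bounded[of v s] by simp
    have ws: "dist (apply_bcontfun w s) (apply_bcontfun v s) < min d 1"
      using dist_bounded[of w s v] w by linarith
    have "(s, apply_bcontfun w s) \<in> D" "(s, apply_bcontfun v s) \<in> D"
      using s vs ws by (auto simp: D_def dist_real_def)
    from d(2)[OF this(2,1)] show "\<bar>g s (apply_bcontfun w s) - g s (apply_bcontfun v s)\<bar> < \<eta>"
      using ws by (simp add: dist_Pair_Pair dist_real_def)
  qed
qed

lemma integral_lipschitz:
  fixes h :: "real \<Rightarrow> real"
  assumes "continuous_on {0..T} h" "\<And>t. t \<in> {0..T} \<Longrightarrow> \<bar>h t\<bar> \<le> L" "s \<in> {0..T}" "t \<in> {0..T}"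
  shows "\<bar>integral {0..s} h - integral {0..t} h\<bar> \<le> L * \<bar>s - t\<bar>"
proof -
  have *: "\<bar>integral {0..s} h - integral {0..t} h\<bar> \<le> L * \<bar>s - t\<bar>"
    if "s \<in> {0..T}" "t \<in> {0..T}" "s \<le> t" for s t
  proof -
    have "h integrable_on {0..t}"
      using assms(1) that by (intro integrable_continuous_real) (auto elim: continuous_on_subset)
    then have "integral {0..t} h = integral {0..s} h + integral {s..t} h"
      using that by (intro Henstock_Kurzweil_Integration.integral_combine[symmetric]) auto
    moreover have "norm (integral {s..t} h) \<le> L * (t - s)"
      using that assms(2)
      by (intro integral_bound) (auto intro!: continuous_on_subset[OF assms(1)])
    ultimately show ?thesis
      using that by simp
  qed
  show ?thesis
    using *[of s t] *[of t s] assms(3,4) by (cases "s \<le> t") (auto simp: abs_minus_commute)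
qed

lemma continuous_on_integral_upper:
  fixes h :: "real \<Rightarrow> real"
  assumes "continuous_on {0..T} h"
  shows "continuous_on {0..T} (\<lambda>t. integral {0..t} h)"
  using assms by (intro indefinite_integral_continuous_1 integrable_continuous_real)

lemma integral_upper_halfline_derivative:
  fixes h :: "real \<Rightarrow> real"
  assumes "continuous_on {l..} h" "t \<ge> l"
  shows "((\<lambda>t. integral {l..t} h) has_real_derivative h t) (at t within {l..})"
proof -
  have "at t within {l..} = at t within {l..t+1}"
    by (rule at_within_nhd[of t "{..<t+1}"]) auto
  moreover have "((\<lambda>t. integral {l..t} h) has_real_derivative h t) (at t within {l..t+1})"
    using assms by (intro integral_has_real_derivative) (auto elim: continuous_on_subset)
  ultimately show ?thesis
    by simp
qed

section \<open>Continuation of solutions\<close>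

text \<open>
  Integrating \<open>(p u')' + g t u = 0\<close> twice from the initial data \<open>u 0 = u0\<close> and \<open>p 0 * u' 0 = q0\<close>
  gives the fixed point equation \<open>u = volterra p g u0 q0 u\<close>.
\<close>

definition momentum :: "(real \<Rightarrow> real \<Rightarrow> real) \<Rightarrow> real \<Rightarrow> (real \<Rightarrow> real) \<Rightarrow> real \<Rightarrow> real" where
  "momentum g q0 u t = q0 - integral {0..t} (\<lambda>s. g s (u s))"

definition volterra :: "(real \<Rightarrow> real) \<Rightarrow> (real \<Rightarrow> real \<Rightarrow> real) \<Rightarrow> real \<Rightarrow> real \<Rightarrow> (real \<Rightarrow> real) \<Rightarrow> real \<Rightarrow> real" where
  "volterra p g u0 q0 u t = u0 + integral {0..t} (\<lambda>\<tau>. momentum g q0 u \<tau> / p \<tau>)"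

lemma momentum_cong: "(\<And>s. s \<in> {0..t} \<Longrightarrow> u s = v s) \<Longrightarrow> momentum g q0 u t = momentum g q0 v t"
  unfolding momentum_def by (intro arg_cong2[of _ _ _ _ minus] refl integral_cong) auto

text \<open>Causality: this is what keeps a solution on an initial interval intact when it is
  continued.\<close>

lemma volterra_cong: "(\<And>s. s \<in> {0..t} \<Longrightarrow> u s = v s) \<Longrightarrow> volterra p g u0 q0 u t = volterra p g u0 q0 v t"
  unfolding volterra_def
  by (intro arg_cong2[of _ _ _ _ plus] arg_cong2[of _ _ _ _ divide] refl integral_cong momentum_cong) auto

text \<open>The bound on \<open>g\<close> is uniform in the unknown; it rules out blow-up and makes
  the Volterra operator compact on each bounded interval.\<close>

locale volterra_equation =
  fixes p :: "real \<Rightarrow> real" and g :: "real \<Rightarrow> real \<Rightarrow> real" and u0 q0 :: real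
  assumes p_cont: "continuous_on {0..} p" and p_pos: "\<And>t. t \<ge> 0 \<Longrightarrow> p t > 0"
    and g_cont: "continuous_on ({0..} \<times> UNIV) (\<lambda>(t, x). g t x)"
    and g_bounded: "\<And>T. \<exists>B. \<forall>t\<in>{0..T}. \<forall>x. \<bar>g t x\<bar> \<le> B"
begin

lemma p_nonzero: "t \<ge> 0 \<Longrightarrow> p t \<noteq> 0"
  using p_pos[of t] by simp

lemma g_comp_cont:
  assumes "continuous_on S u" "S \<subseteq> {0..}"
  shows "continuous_on S (\<lambda>s. g s (u s))"
proof -
  have "continuous_on S (\<lambda>s. case (s, u s) of (t, x) \<Rightarrow> g t x)"
    by (rule continuous_on_compose2[OF g_cont]) (use assms in \<open>auto intro!: continuous_intros\<close>)
  then show ?thesis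
    by simp
qed

lemma p_lower:
  assumes "T \<ge> 0"
  obtains c where "c > 0" "\<And>t. t \<in> {0..T} \<Longrightarrow> c \<le> p t"
proof -
  have "continuous_on {0..T} p"
    by (rule continuous_on_subset[OF p_cont]) auto
  then obtain t where "t \<in> {0..T}" "\<And>s. s \<in> {0..T} \<Longrightarrow> p t \<le> p s"
    using continuous_attains_inf[of "{0..T}" p] assms by auto
  then show ?thesis
    using that[of "p t"] p_pos by auto
qed

lemma momentum_cont:
  assumes "continuous_on {0..T} u"
  shows "continuous_on {0..T} (momentum g q0 u)"
  unfolding momentum_def
  by (intro continuous_intros continuous_on_integral_upper g_comp_cont assms) auto

lemma volterra_integrand_cont:
  assumes "continuous_on {0..T} u"
  shows "continuous_on {0..T} (\<lambda>\<tau>. momentum g q0 u \<tau> / p \<tau>)"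
  by (intro continuous_intros momentum_cont assms continuous_on_subset[OF p_cont]) (auto simp: p_nonzero)

text \<open>The constants do not depend on \<open>u\<close> because the bound on \<open>g\<close>
  does not; hence the whole range of the operator lies in one set of the form
  \<open>lipschitz_fns\<close>.\<close>

lemma volterra_bounds:
  assumes "T \<ge> 0"
  obtains Q L where "L \<ge> 0"
    "\<And>u t. continuous_on {0..T} u \<Longrightarrow> t \<in> {0..T} \<Longrightarrow> \<bar>volterra p g u0 q0 u t\<bar> \<le> Q"
    "\<And>u s t. continuous_on {0..T} u \<Longrightarrow> s \<in> {0..T} \<Longrightarrow> t \<in> {0..T} \<Longrightarrow>
      \<bar>volterra p g u0 q0 u s - volterra p g u0 q0 u t\<bar> \<le> L * \<bar>s - t\<bar>"
proof -
  obtain c where c: "c > 0" "\<And>t. t \<in> {0..T} \<Longrightarrow> c \<le> p t"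
    using p_lower[OF assms] by blast
  obtain B where B: "\<And>t x. t \<in> {0..T} \<Longrightarrow> \<bar>g t x\<bar> \<le> B"
    using g_bounded[of T] by blast
  have "B \<ge> 0"
    using B[of 0 0] assms by auto
  define L where "L = (\<bar>q0\<bar> + B * T) / c"
  have "L \<ge> 0"
    using c \<open>B \<ge> 0\<close> assms by (simp add: L_def)
  have integrand: "\<bar>momentum g q0 u t / p t\<bar> \<le> L" if u: "continuous_on {0..T} u" and t: "t \<in> {0..T}" for u t
  proof -
    have "\<bar>integral {0..t} (\<lambda>s. g s (u s)) - integral {0..0} (\<lambda>s. g s (u s))\<bar> \<le> B * \<bar>t - 0\<bar>"
      using B t assms by (intro integral_lipschitz[where T=T] g_comp_cont[OF u]) auto
    also have "\<dots> \<le> B * T"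
      using t \<open>B \<ge> 0\<close> by (intro mult_left_mono) auto
    finally have "\<bar>momentum g q0 u t\<bar> \<le> \<bar>q0\<bar> + B * T"
      by (simp add: momentum_def)
    moreover have "\<bar>momentum g q0 u t / p t\<bar> = \<bar>momentum g q0 u t\<bar> / p t"
      using c(1) c(2)[OF t] by (simp add: abs_divide)
    ultimately show ?thesis
      using c(2)[OF t] c(1) by (auto simp: L_def intro!: frac_le)
  qed
  have lip: "\<bar>volterra p g u0 q0 u s - volterra p g u0 q0 u t\<bar> \<le> L * \<bar>s - t\<bar>"
    if u: "continuous_on {0..T} u" and "s \<in> {0..T}" "t \<in> {0..T}" for u s t
    using integral_lipschitz[OF volterra_integrand_cont[OF u] integrand[OF u] that(2,3)]
    by (simp add: volterra_def)
  moreover have "\<bar>volterra p g u0 q0 u t\<bar> \<le> \<bar>u0\<bar> + L * T" if u: "continuous_on {0..T} u" and t: "t \<in> {0..T}" for u t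
  proof -
    have "L * \<bar>t - 0\<bar> \<le> L * T"
      using t \<open>L \<ge> 0\<close> by (intro mult_left_mono) auto
    then show ?thesis
      using lip[OF u t, of 0] t by (simp add: volterra_def)
  qed
  ultimately show ?thesis
    using that[of L "\<bar>u0\<bar> + L * T"] \<open>L \<ge> 0\<close> by blast
qed

lemma volterra_continuous:
  assumes "T \<ge> 0" "\<epsilon> > 0"
  obtains \<delta> where "\<delta> > 0" "\<And>w t. dist w v < \<delta> \<Longrightarrow> t \<in> {0..T} \<Longrightarrow>
    \<bar>volterra p g u0 q0 (apply_bcontfun w) t - volterra p g u0 q0 (apply_bcontfun v) t\<bar> \<le> \<epsilon>"
proof -
  obtain c where c: "c > 0" "\<And>t. t \<in> {0..T} \<Longrightarrow> c \<le> p t"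
    using p_lower[OF assms(1)] by blast
  \<comment> \<open>Two integrations over length at most \<open>T\<close> and one division by
    \<open>p \<ge> c\<close> turn an error \<open>\<eta>\<close> into at most
    \<open>\<eta> * T * T / c\<close>; the summand 1 covers \<open>T = 0\<close>.\<close>
  define \<eta> where "\<eta> = \<epsilon> * c / (T * T + 1)"
  have pos: "T * T + 1 > 0"
    using assms by (auto intro: add_nonneg_pos)
  have "\<eta> > 0"
    using assms c pos by (simp add: \<eta>_def)
  have "continuous_on ({0..T} \<times> UNIV) (\<lambda>(t, x). g t x)"
    by (rule continuous_on_subset[OF g_cont]) auto
  then obtain \<delta> where \<delta>: "\<delta> > 0" "\<And>w s. dist w v < \<delta> \<Longrightarrow> s \<in> {0..T} \<Longrightarrow>
      \<bar>g s (apply_bcontfun w s) - g s (apply_bcontfun v s)\<bar> < \<eta>"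
    using superposition_continuous[OF _ \<open>\<eta> > 0\<close>] by blast
  show ?thesis
  proof (rule that[OF \<delta>(1)])
    fix w t assume w: "dist w v < \<delta>" and t: "t \<in> {0..T}"
    let ?m = "\<lambda>u. momentum g q0 (apply_bcontfun u)"
    have cont: "continuous_on {0..t} (\<lambda>s. g s (apply_bcontfun u s))" for u t
      by (intro g_comp_cont) auto
    have m: "\<bar>?m w \<tau> - ?m v \<tau>\<bar> \<le> \<eta> * T" if \<tau>: "\<tau> \<in> {0..T}" for \<tau>
    proof -
      have "\<bar>?m w \<tau> - ?m v \<tau>\<bar> = norm (integral {0..\<tau>}
          (\<lambda>s. g s (apply_bcontfun w s) - g s (apply_bcontfun v s)))"
        by (subst integral_diff)
          (auto simp: momentum_def intro!: integrable_continuous_real cont)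
      also have "\<dots> \<le> \<eta> * (\<tau> - 0)"
        using \<tau> \<delta>(2)[OF w]
        by (intro integral_bound continuous_intros cont) (auto simp: less_imp_le)
      also have "\<dots> \<le> \<eta> * T"
        using \<tau> \<open>\<eta> > 0\<close> by (intro mult_left_mono) auto
      finally show ?thesis .
    qed
    have cont2: "continuous_on {0..t} (\<lambda>\<tau>. ?m u \<tau> / p \<tau>)" for u
      by (intro volterra_integrand_cont) auto
    have "\<bar>volterra p g u0 q0 (apply_bcontfun w) t - volterra p g u0 q0 (apply_bcontfun v) t\<bar> =
        norm (integral {0..t} (\<lambda>\<tau>. ?m w \<tau> / p \<tau> - ?m v \<tau> / p \<tau>))"
      by (subst integral_diff)
        (auto simp: volterra_def intro!: integrable_continuous_real cont2)
    also have "\<dots> \<le> (\<eta> * T / c) * (t - 0)"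
    proof (rule integral_bound)
      show "continuous_on {0..t} (\<lambda>\<tau>. ?m w \<tau> / p \<tau> - ?m v \<tau> / p \<tau>)"
        by (intro continuous_on_diff cont2)
    next
      fix \<tau> assume "\<tau> \<in> {0..t}"
      then have \<tau>: "\<tau> \<in> {0..T}"
        using t by auto
      have "norm (?m w \<tau> / p \<tau> - ?m v \<tau> / p \<tau>) = \<bar>?m w \<tau> - ?m v \<tau>\<bar> / p \<tau>"
        using c(1) c(2)[OF \<tau>] by (simp add: diff_divide_distrib[symmetric] abs_divide)
      also have "\<dots> \<le> \<eta> * T / c"
        using m[OF \<tau>] c(1) c(2)[OF \<tau>] by (intro frac_le) auto
      finally show "norm (?m w \<tau> / p \<tau> - ?m v \<tau> / p \<tau>) \<le> \<eta> * T / c" .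
    qed (use t in auto)
    also have "\<dots> \<le> (\<eta> * T / c) * T"
      using t \<open>\<eta> > 0\<close> c by (intro mult_left_mono) auto
    also have "\<dots> = \<epsilon> * (T * T) / (T * T + 1)"
      using c by (simp add: \<eta>_def)
    also have "\<dots> \<le> \<epsilon>"
      using pos assms by (simp add: divide_le_eq mult_left_mono)
    finally show "\<bar>volterra p g u0 q0 (apply_bcontfun w) t - volterra p g u0 q0 (apply_bcontfun v) t\<bar> \<le> \<epsilon>" .
  qed
qed

text \<open>
  The functions that agree with a given solution on an initial interval form a convex set which
  the Volterra operator maps into itself, so that Schauder's theorem continues the solution.
\<close>

lemma volterra_extend:
  assumes "0 \<le> T" "T \<le> T'" and U: "continuous_on {0..T} U" "\<And>t. t \<in> {0..T} \<Longrightarrow> U t = volterra p g u0 q0 U t"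
  obtains W where "continuous_on {0..T'} W" "\<And>t. t \<in> {0..T} \<Longrightarrow> W t = U t"
    "\<And>t. t \<in> {0..T'} \<Longrightarrow> W t = volterra p g u0 q0 W t"
proof -
  have "0 \<le> T'"
    using assms by simp
  define K where "K = {v :: real \<Rightarrow>\<^sub>C real. \<forall>t\<in>{0..T}. apply_bcontfun v t = U t}"
  define A where "A v = clamp_ext 0 T' (volterra p g u0 q0 (apply_bcontfun v))" for v
  obtain Q L where L: "L \<ge> 0"
    "\<And>u t. continuous_on {0..T'} u \<Longrightarrow> t \<in> {0..T'} \<Longrightarrow> \<bar>volterra p g u0 q0 u t\<bar> \<le> Q"
    "\<And>u s t. continuous_on {0..T'} u \<Longrightarrow> s \<in> {0..T'} \<Longrightarrow> t \<in> {0..T'} \<Longrightarrow>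
      \<bar>volterra p g u0 q0 u s - volterra p g u0 q0 u t\<bar> \<le> L * \<bar>s - t\<bar>"
    by (rule volterra_bounds[OF \<open>0 \<le> T'\<close>]) (rule that; assumption)
  have A_lip: "A v \<in> lipschitz_fns 0 T' Q L" for v
    unfolding A_def by (intro clamp_ext_in_lipschitz_fns L \<open>0 \<le> T'\<close>) auto
  have "L-lipschitz_on {0..T'} (volterra p g u0 q0 (apply_bcontfun v))" for v
    using L by (auto simp: lipschitz_on_def dist_real_def)
  then have A_apply: "apply_bcontfun (A v) t = volterra p g u0 q0 (apply_bcontfun v) (max 0 (min T' t))" for v t
    unfolding A_def by (intro clamp_ext_apply \<open>0 \<le> T'\<close> lipschitz_on_continuous_on)
  define C where "C = lipschitz_fns 0 T' Q L \<inter> K"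
  have "K = PiC {0..T} (\<lambda>t. {U t})"
    by (auto simp: K_def mem_PiC_iff Pi_iff)
  then have "closed K"
    by (simp add: closed_PiC)
  then have "compact C"
    using compact_lipschitz_fns[OF \<open>0 \<le> T'\<close> L(1)] by (auto simp: C_def)
  have "convex K"
  proof (rule convexI)
    fix x y and c d :: real assume "x \<in> K" "y \<in> K" "c + d = 1"
    moreover have "c * z + d * z = z" for z
      using \<open>c + d = 1\<close> by (metis distrib_right mult_1)
    ultimately show "c *\<^sub>R x + d *\<^sub>R y \<in> K"
      by (simp add: K_def)
  qed
  have "clamp_ext 0 T U \<in> K"
    using clamp_ext_apply[OF assms(1) U(1)] by (simp add: K_def)
  then have "K \<noteq> {}"
    by blast
  have "A ` K \<subseteq> K"
  proof safe
    fix v assume v: "v \<in> K"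
    \<comment> \<open>On the initial interval \<open>v\<close> is \<open>U\<close>, and by causality
      the operator there sees only \<open>U\<close>, which is a solution.\<close>
    have "volterra p g u0 q0 (apply_bcontfun v) t = U t" if "t \<in> {0..T}" for t
      using v that U(2)[OF that] volterra_cong[of t "apply_bcontfun v" U] by (auto simp: K_def)
    then show "A v \<in> K"
      using assms by (auto simp: K_def A_apply)
  qed
  then have "A ` K \<subseteq> C"
    using A_lip by (auto simp: C_def)
  have "continuous_on K A"
    unfolding continuous_on_iff
  proof (intro ballI allI impI)
    fix v and e :: real assume "e > 0"
    then obtain \<delta> where \<delta>: "\<delta> > 0" "\<And>w t. dist w v < \<delta> \<Longrightarrow> t \<in> {0..T'} \<Longrightarrow>
      \<bar>volterra p g u0 q0 (apply_bcontfun w) t - volterra p g u0 q0 (apply_bcontfun v) t\<bar> \<le> e/2"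
      by (metis volterra_continuous[OF \<open>0 \<le> T'\<close>] half_gt_zero)
    have "dist (A w) (A v) \<le> e/2" if "dist w v < \<delta>" for w
      by (rule dist_bound, unfold A_apply dist_real_def, rule \<delta>(2)[OF that]) (use \<open>0 \<le> T'\<close> in auto)
    then show "\<exists>d>0. \<forall>x'\<in>K. dist x' v < d \<longrightarrow> dist (A x') (A v) < e"
      using \<delta>(1) \<open>e > 0\<close> by (intro exI[of _ \<delta>]) force
  qed
  then obtain v where v: "v \<in> C" "A v = v"
    using schauder_fixed_point[OF \<open>convex K\<close> \<open>K \<noteq> {}\<close> _ \<open>compact C\<close> _ \<open>A ` K \<subseteq> C\<close>] by (auto simp: C_def)
  show ?thesis
  proof (rule that[of "apply_bcontfun v"])
    show "apply_bcontfun v t = U t" if "t \<in> {0..T}" for t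
      using v that by (auto simp: C_def K_def)
    show "apply_bcontfun v t = volterra p g u0 q0 (apply_bcontfun v) t" if "t \<in> {0..T'}" for t
      using A_apply[of v t] v that by simp
  qed auto
qed

text \<open>Without uniqueness, solutions on longer and longer intervals need not agree; dependent
  choice selects each one as an extension of its predecessor, and the sequence is then
  glued.\<close>

lemma volterra_extend_halfline:
  assumes "0 \<le> T" and U: "continuous_on {0..T} U" "\<And>t. t \<in> {0..T} \<Longrightarrow> U t = volterra p g u0 q0 U t"
  obtains u where "continuous_on {0..} u" "\<And>t. t \<in> {0..T} \<Longrightarrow> u t = U t"
    "\<And>t. t \<ge> 0 \<Longrightarrow> u t = volterra p g u0 q0 u t"
proof -
  define P where "P n W \<longleftrightarrow> continuous_on {0..T + real n} W \<and> (\<forall>t\<in>{0..T}. W t = U t) \<and>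
    (\<forall>t\<in>{0..T + real n}. W t = volterra p g u0 q0 W t)" for n W
  have "\<exists>W. P (Suc n) W \<and> (\<forall>t\<in>{0..T + real n}. W t = V t)" if "P n V" for n V
  proof -
    obtain W where W: "continuous_on {0..T + real (Suc n)} W" "\<And>t. t \<in> {0..T + real n} \<Longrightarrow> W t = V t"
      "\<And>t. t \<in> {0..T + real (Suc n)} \<Longrightarrow> W t = volterra p g u0 q0 W t"
    proof (rule volterra_extend[of "T + real n" "T + real (Suc n)" V])
      show "V t = volterra p g u0 q0 V t" if "t \<in> {0..T + real n}" for t
        using \<open>P n V\<close> that unfolding P_def by blast
    qed (use \<open>P n V\<close> \<open>0 \<le> T\<close> in \<open>auto simp: P_def\<close>)
    have "W t = U t" if "t \<in> {0..T}" for t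
      using W(2)[of t] \<open>P n V\<close> that by (simp add: P_def)
    then have "P (Suc n) W"
      using W(1,3) unfolding P_def by blast
    then show ?thesis
      using W(2) by blast
  qed
  moreover have "P 0 U"
    using U by (simp add: P_def)
  ultimately have "\<exists>W. \<forall>n. P n (W n) \<and> (\<forall>t\<in>{0..T + real n}. W (Suc n) t = W n t)"
    by (intro dependent_nat_choice) blast+
  then obtain W where W: "\<And>n. P n (W n)" and step: "\<And>n t. t \<in> {0..T + real n} \<Longrightarrow> W (Suc n) t = W n t"
    by blast
  have mono: "W (n + k) t = W n t" if "t \<in> {0..T + real n}" for n k t
  proof (induction k)
    case (Suc k)
    then show ?case
      using step[of t "n + k"] that by auto
  qed simp
  \<comment> \<open>Any index whose interval contains \<open>t\<close> gives the same value; the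
    ceiling is one, as \<open>t\<close> is at most its ceiling and \<open>T\<close> is
    nonnegative.\<close>
  define u where "u t = W (nat \<lceil>t\<rceil>) t" for t
  have u_eq: "u t = W n t" if t: "t \<in> {0..T + real n}" for n t
  proof (cases "nat \<lceil>t\<rceil> \<le> n")
    case True
    have "t \<le> real (nat \<lceil>t\<rceil>)"
      by linarith
    then show ?thesis
      using mono[of t "nat \<lceil>t\<rceil>" "n - nat \<lceil>t\<rceil>"] True t \<open>0 \<le> T\<close> by (simp add: u_def)
  next
    case False
    then have "n + (nat \<lceil>t\<rceil> - n) = nat \<lceil>t\<rceil>"
      by linarith
    then show ?thesis
      using mono[OF t, of "nat \<lceil>t\<rceil> - n"] by (simp only: u_def)
  qed
  have cont_n: "continuous_on {0..T + real n} u" for n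
  proof -
    have "continuous_on {0..T + real n} (W n)"
      using W[of n] unfolding P_def by blast
    then show ?thesis
      by (rule continuous_on_eq) (use u_eq in auto)
  qed
  have "continuous_on {0..} u"
    unfolding continuous_on_eq_continuous_within
  proof
    fix t :: real assume "t \<in> {0..}"
    obtain n where n: "t < real n"
      using reals_Archimedean2 by blast
    have "continuous (at t within {0..T + real n}) u"
      using cont_n[of n] n \<open>t \<in> {0..}\<close> \<open>0 \<le> T\<close> by (simp add: continuous_on_eq_continuous_within)
    moreover have "at t within {0..} = at t within {0..T + real n}"
      using n \<open>0 \<le> T\<close> by (intro at_within_nhd[of t "{..<T + real n}"]) auto
    ultimately show "continuous (at t within {0..}) u"
      by simp
  qed
  moreover have "u t = U t" if "t \<in> {0..T}" for t
    using u_eq[of t 0] W[of 0] that by (simp add: P_def)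
  moreover have "u t = volterra p g u0 q0 u t" if "t \<ge> 0" for t
  proof -
    obtain n where n: "t \<le> T + real n"
      using real_arch_simple[of t] \<open>0 \<le> T\<close> by (metis add_increasing)
    then have "u t = volterra p g u0 q0 (W n) t"
      using u_eq[of t n] W[of n] that by (simp add: P_def)
    also have "\<dots> = volterra p g u0 q0 u t"
      by (rule volterra_cong) (use n in \<open>auto intro!: u_eq[symmetric]\<close>)
    finally show ?thesis .
  qed
  ultimately show ?thesis
    using that by blast
qed

lemma volterra_derivatives:
  assumes u: "continuous_on {0..} u" "\<And>t. t \<ge> 0 \<Longrightarrow> u t = volterra p g u0 q0 u t" and "t \<ge> 0"
  shows "(u has_real_derivative momentum g q0 u t / p t) (at t within {0..})"
    and "(momentum g q0 u has_real_derivative - g t (u t)) (at t within {0..})"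
    and "continuous_on {0..} (\<lambda>s. momentum g q0 u s / p s)"
proof -
  have g: "continuous_on {0..} (\<lambda>s. g s (u s))"
    by (rule g_comp_cont[OF u(1)]) simp
  have m: "(momentum g q0 u has_real_derivative - g t (u t)) (at t within {0..})" if "t \<ge> 0" for t
    unfolding momentum_def
    using DERIV_diff[OF DERIV_const integral_upper_halfline_derivative[OF g that]] by simp
  then show "(momentum g q0 u has_real_derivative - g t (u t)) (at t within {0..})"
    using \<open>t \<ge> 0\<close> by blast
  have "continuous_on {0..} (momentum g q0 u)"
    using m by (intro DERIV_continuous_on) auto
  then show cont: "continuous_on {0..} (\<lambda>s. momentum g q0 u s / p s)"
    by (intro continuous_intros p_cont) (auto simp: p_nonzero)
  have "(volterra p g u0 q0 u has_real_derivative momentum g q0 u t / p t) (at t within {0..})"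
    unfolding volterra_def[abs_def]
    using DERIV_add[OF DERIV_const integral_upper_halfline_derivative[OF cont \<open>t \<ge> 0\<close>]] by simp
  then show "(u has_real_derivative momentum g q0 u t / p t) (at t within {0..})"
    by (rule has_field_derivative_transform_within[where d=1]) (use u(2) \<open>t \<ge> 0\<close> in auto)
qed

end

section \<open>The boundary value problem on the interval\<close>

lemma restrict_in_C0R:
  assumes "continuous_on {0..R} u"
  shows "restrict u {0..R} \<in> mspace (C0R R)"
proof -
  have "bounded (u ` {0..R})"
    using assms by (intro compact_imp_bounded compact_continuous_image) auto
  moreover have "restrict u {0..R} ` {0..R} = u ` {0..R}"
    by auto
  moreover have "continuous_on {0..R} (restrict u {0..R})"
    by (rule continuous_on_eq[OF assms]) auto
  ultimately show ?thesis
    by (simp add: C0R_def Met_TC.mbounded_def bounded_def)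
qed

locale halfline_problem =
  fixes R \<alpha> \<beta> a b :: real and p :: "real \<Rightarrow> real" and f :: "real \<Rightarrow> real \<Rightarrow> real"
    and H :: "(real \<Rightarrow> real) \<Rightarrow> real"
  assumes R_pos: "R > 0" and \<alpha>_pos: "\<alpha> > 0" and \<beta>_nonneg: "\<beta> \<ge> 0"
    and ab: "0 \<le> a" "a < b" "b \<le> R" "\<beta> = 0 \<Longrightarrow> a > 0"
    and p_cont: "continuous_on {0..} p" and p_pos: "\<And>t. t \<ge> 0 \<Longrightarrow> p t > 0"
    and f_cont: "continuous_on ({0..} \<times> {0..}) (\<lambda>(t, v). f t v)"
    and f_nonneg: "\<And>t v. t \<in> {0..R} \<Longrightarrow> v \<ge> 0 \<Longrightarrow> f t v \<ge> 0"
    and H_adm: "admissible_H \<alpha> \<beta> p R a b H"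
begin

lemma p_nonzero: "t \<ge> 0 \<Longrightarrow> p t \<noteq> 0"
  using p_pos[of t] by simp

lemma inverse_p_cont: "continuous_on {0..} (\<lambda>\<mu>. 1 / p \<mu>)"
  by (intro continuous_intros p_cont) (auto simp: p_nonzero)

text \<open>The solution of \<open>(p u')' = 0\<close> with
  \<open>\<alpha> * u 0 - \<beta> * u' 0 = 0\<close>, normalised by \<open>p u' = \<alpha>\<close>.
  Both the kernel and the function c(t) are built from it.\<close>

definition \<Phi> :: "real \<Rightarrow> real" where
  "\<Phi> t = \<beta> / p 0 + \<alpha> * integral {0..t} (\<lambda>\<mu>. 1 / p \<mu>)"

lemma \<Phi>_deriv: "t \<ge> 0 \<Longrightarrow> (\<Phi> has_real_derivative \<alpha> / p t) (at t within {0..})"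
  unfolding \<Phi>_def
  using DERIV_add[OF DERIV_const DERIV_cmult[OF integral_upper_halfline_derivative[OF inverse_p_cont]], of t]
  by simp

lemma \<Phi>_cont: "continuous_on {0..} \<Phi>"
  using \<Phi>_deriv by (intro DERIV_continuous_on) auto

lemma \<Phi>_strict_mono:
  assumes "0 \<le> s" "s < t"
  shows "\<Phi> s < \<Phi> t"
proof (rule DERIV_pos_imp_increasing_open[OF \<open>s < t\<close>])
  fix x assume "s < x" "x < t"
  then have "at x within {0..} = at x"
    using assms by (intro at_within_interior) auto
  then show "\<exists>y. (\<Phi> has_real_derivative y) (at x) \<and> 0 < y"
    using \<Phi>_deriv[of x] \<alpha>_pos p_pos[of x] assms \<open>s < x\<close> by (intro exI[of _ "\<alpha> / p x"]) auto
qed (use assms in \<open>auto intro: continuous_on_subset[OF \<Phi>_cont]\<close>)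

lemma \<Phi>_mono: "0 \<le> s \<Longrightarrow> s \<le> t \<Longrightarrow> \<Phi> s \<le> \<Phi> t"
  using \<Phi>_strict_mono[of s t] by (cases "s = t") auto

lemma \<Phi>_0: "\<Phi> 0 = \<beta> / p 0"
  by (simp add: \<Phi>_def)

lemma \<Phi>_nonneg: "t \<ge> 0 \<Longrightarrow> \<Phi> t \<ge> 0"
  using \<Phi>_mono[of 0 t] divide_nonneg_pos[OF \<beta>_nonneg p_pos[of 0]] \<Phi>_0 by simp

text \<open>Here the requirement \<open>a > 0\<close> for \<open>\<beta> = 0\<close> enters: in that
  case \<open>\<Phi>\<close> vanishes at 0. Positivity of the cone constant follows.\<close>

lemma \<Phi>_a_pos: "\<Phi> a > 0"
proof (cases "\<beta> = 0")
  case True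
  have "\<Phi> 0 = 0"
    unfolding \<Phi>_0 using True by simp
  moreover have "0 < a"
    using True ab by blast
  ultimately show ?thesis
    using \<Phi>_strict_mono[of 0 a] by simp
next
  case False
  then have "\<Phi> 0 > 0"
    using \<beta>_nonneg p_pos[of 0] by (simp add: \<Phi>_0)
  then show ?thesis
    using \<Phi>_mono[of 0 a] ab by simp
qed

lemma \<Phi>_R_pos: "\<Phi> R > 0"
  using \<Phi>_a_pos \<Phi>_mono[of a R] ab by simp

lemma kernel_eq: "kernel_k \<alpha> \<beta> p t s = \<Phi> (min s t) / \<alpha>"
  by (simp add: kernel_k_def \<Phi>_def)

abbreviation c :: real where
  "c \<equiv> c_min \<alpha> \<beta> p R a b"

lemma c_eq: "c = \<Phi> a / \<Phi> R"
proof -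
  have *: "\<Phi> a / \<Phi> R \<le> \<Phi> t / \<Phi> R" if "t \<in> {a..b}" for t
    using that ab \<Phi>_R_pos by (intro divide_right_mono \<Phi>_mono) auto
  have "c = (INF t\<in>{a..b}. \<Phi> t / \<Phi> R)"
    by (simp add: c_min_def c_fun_def \<Phi>_def)
  also have "\<dots> = \<Phi> a / \<Phi> R"
    by (rule cInf_eq_minimum) (use * ab in auto)
  finally show ?thesis .
qed

lemma c_pos: "c > 0" and c_le_1: "c \<le> 1"
  using \<Phi>_a_pos \<Phi>_R_pos \<Phi>_mono[of a R] ab by (auto simp: c_eq)

text \<open>The cone of the paper, with functions on $[0,R]$ extended by constants to the whole line.\<close>

definition K :: "(real \<Rightarrow>\<^sub>C real) set" where
  "K = {v. (\<forall>t. apply_bcontfun v t = apply_bcontfun v (max 0 (min R t))) \<and>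
     (\<forall>t. 0 \<le> apply_bcontfun v t) \<and> (\<forall>t\<in>{a..b}. c * norm v \<le> apply_bcontfun v t)}"

lemma K_clamp: "v \<in> K \<Longrightarrow> apply_bcontfun v t = apply_bcontfun v (max 0 (min R t))"
  unfolding K_def by blast

lemma K_nonneg: "v \<in> K \<Longrightarrow> 0 \<le> apply_bcontfun v t"
  unfolding K_def by blast

lemma K_lower: "v \<in> K \<Longrightarrow> t \<in> {a..b} \<Longrightarrow> c * norm v \<le> apply_bcontfun v t"
  unfolding K_def by blast

text \<open>The passage from constant extensions back to the extensional functions on which
  \<open>H\<close> acts.\<close>

definition J :: "(real \<Rightarrow>\<^sub>C real) \<Rightarrow> real \<Rightarrow> real" where
  "J v = restrict (apply_bcontfun v) {0..R}"

definition e :: "real \<Rightarrow>\<^sub>C real" where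
  "e = const_bcontfun 1"

sublocale cone: normed_cone K e
proof
  show "convex K"
  proof (rule convexI)
    fix x y and r s :: real assume xy: "x \<in> K" "y \<in> K" and rs: "0 \<le> r" "0 \<le> s"
    have "c * norm (r *\<^sub>R x + s *\<^sub>R y) \<le> r * apply_bcontfun x t + s * apply_bcontfun y t"
      if t: "t \<in> {a..b}" for t
    proof -
      have "c * norm (r *\<^sub>R x + s *\<^sub>R y) \<le> c * (r * norm x + s * norm y)"
        using norm_triangle_ineq[of "r *\<^sub>R x" "s *\<^sub>R y"] rs c_pos by (intro mult_left_mono) auto
      also have "\<dots> = r * (c * norm x) + s * (c * norm y)"
        by (simp add: algebra_simps)
      also have "\<dots> \<le> r * apply_bcontfun x t + s * apply_bcontfun y t"
        using xy t rs by (intro add_mono mult_left_mono) (auto simp: K_def)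
      finally show ?thesis .
    qed
    moreover have "apply_bcontfun x t = apply_bcontfun x (max 0 (min R t))"
      "apply_bcontfun y t = apply_bcontfun y (max 0 (min R t))" for t
      using xy by (auto simp: K_def)
    ultimately show "r *\<^sub>R x + s *\<^sub>R y \<in> K"
      using xy rs by (auto simp: K_def)
  qed
  show "r *\<^sub>R x \<in> K" if "x \<in> K" "r \<ge> 0" for x r
  proof -
    have "c * norm (r *\<^sub>R x) \<le> r * apply_bcontfun x t" if "t \<in> {a..b}" for t
    proof -
      have "r * (c * norm x) \<le> r * apply_bcontfun x t"
        using \<open>x \<in> K\<close> \<open>r \<ge> 0\<close> that by (intro mult_left_mono) (auto simp: K_def)
      then show ?thesis
        using \<open>r \<ge> 0\<close> by (simp add: mult.left_commute)
    qed
    moreover have "apply_bcontfun x t = apply_bcontfun x (max 0 (min R t))" for t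
      using that by (auto simp: K_def)
    ultimately show ?thesis
      using that by (auto simp: K_def)
  qed
  \<comment> \<open>The constant 1 satisfies the lower bound on \<open>{a..b}\<close> because
    \<open>c\<close> is at most 1.\<close>
  have "norm e \<le> 1"
    by (rule norm_bound) (simp add: e_def)
  then have "c * norm e \<le> 1"
    using c_le_1 c_pos by (intro mult_le_one) auto
  then show "e \<in> K"
    by (simp add: K_def e_def)
  show "norm (x + r *\<^sub>R e) = norm x + r" if "x \<in> K" "r \<ge> 0" for x r
  proof (rule antisym)
    have x: "0 \<le> apply_bcontfun x t" for t
      using that by (simp add: K_def)
    show "norm (x + r *\<^sub>R e) \<le> norm x + r"
      by (rule norm_bound) (use x that norm_bounded[of x] in \<open>simp add: e_def\<close>)
    \<comment> \<open>Members of the cone are nonnegative, so adding a positive constant raises the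
      absolute value at every point by exactly that constant.\<close>
    have "norm x \<le> norm (x + r *\<^sub>R e) - r"
      by (rule norm_bound) (use x that norm_bounded[of "x + r *\<^sub>R e"] in \<open>simp add: e_def le_diff_eq\<close>)
    then show "norm x + r \<le> norm (x + r *\<^sub>R e)"
      by simp
  qed
qed

lemma norm_eq_supnorm:
  assumes "v \<in> K"
  shows "supnorm R (J v) = norm v"
proof (rule antisym)
  have v: "\<bar>J v t\<bar> \<le> norm v" if "t \<in> {0..R}" for t
    using that norm_bounded[of v t] by (simp add: J_def)
  then show "supnorm R (J v) \<le> norm v"
    unfolding supnorm_def using R_pos by (intro cSUP_least) auto
  show "norm v \<le> supnorm R (J v)"
  proof (rule norm_bound)
    fix t
    have "max 0 (min R t) \<in> {0..R}"
      using R_pos by auto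
    moreover from this have "\<bar>J v (max 0 (min R t))\<bar> \<le> supnorm R (J v)"
      unfolding supnorm_def using v by (intro cSUP_upper bdd_aboveI2[where M="norm v"]) auto
    ultimately show "norm (apply_bcontfun v t) \<le> supnorm R (J v)"
      using K_clamp[OF assms, of t] by (simp add: J_def)
  qed
qed

lemma J_in_cone:
  assumes "v \<in> K"
  shows "J v \<in> cone_K \<alpha> \<beta> p R a b"
proof -
  have "J v \<in> mspace (C0R R)"
    unfolding J_def by (rule restrict_in_C0R) simp
  moreover have "c * supnorm R (J v) \<le> (INF t\<in>{a..b}. J v t)"
    unfolding norm_eq_supnorm[OF assms]
    using ab K_lower[OF assms] by (intro cINF_greatest) (auto simp: J_def)
  ultimately show ?thesis
    using K_nonneg[OF assms] by (auto simp: cone_K_def J_def)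
qed

lemma J_in_bdry: "v \<in> K \<Longrightarrow> norm v = \<rho> \<Longrightarrow> J v \<in> bdry_K \<alpha> \<beta> p R a b \<rho>"
  by (simp add: bdry_K_def J_in_cone norm_eq_supnorm)

text \<open>\<open>J\<close> does not increase distances, so the continuity of \<open>H\<close> on
  the metric space of functions on the interval carries over to \<open>K\<close>.\<close>

lemma HJ_cont: "continuous_on K (\<lambda>v. H (J v))"
proof -
  interpret C: Metric_space "mspace (C0R R)" "mdist (C0R R)"
    by (rule Metric_space_mspace_mdist)
  have J: "J v \<in> mspace (C0R R)" for v
    unfolding J_def by (rule restrict_in_C0R) simp
  have "continuous_map (top_of_set K) C.mtopology J"
    unfolding C.continuous_map_to_metric
  proof (intro ballI allI impI)
    fix v and \<epsilon> :: real assume v: "v \<in> topspace (top_of_set K)" and "\<epsilon> > 0"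
    have "J w \<in> C.mball (J v) \<epsilon>" if "w \<in> ball v (\<epsilon>/2)" for w
    proof -
      have "mdist (C0R R) (J v) (J w) \<le> \<epsilon>/2"
        unfolding C0R_def
      proof (rule mdist_cfunspace_le)
        fix t assume "t \<in> topspace (top_of_set {0..R})"
        then show "mdist euclidean_metric (J v t) (J w t) \<le> \<epsilon>/2"
          using dist_bounded[of v t w] that by (simp add: J_def)
      qed (use \<open>\<epsilon> > 0\<close> in simp)
      then show ?thesis
        using \<open>\<epsilon> > 0\<close> J by (simp add: C.in_mball)
    qed
    then show "\<exists>U. openin (top_of_set K) U \<and> v \<in> U \<and> (\<forall>w\<in>U. J w \<in> C.mball (J v) \<epsilon>)"
      using v \<open>\<epsilon> > 0\<close> by (intro exI[of _ "K \<inter> ball v (\<epsilon>/2)"]) auto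
  qed
  then have "continuous_map (top_of_set K) (subtopology (mtopology_of (C0R R)) (cone_K \<alpha> \<beta> p R a b)) J"
    using J_in_cone by (auto simp: continuous_map_in_subtopology mtopology_of_def)
  then have "continuous_map (top_of_set K) euclideanreal (H \<circ> J)"
    using H_adm unfolding admissible_H_def by (blast intro: continuous_map_compose)
  then show ?thesis
    by (simp add: o_def)
qed

lemma H_nonneg: "v \<in> K \<Longrightarrow> 0 \<le> H (J v)"
  using H_adm J_in_cone by (simp add: admissible_H_def)

lemma H_bounded:
  assumes "S \<subseteq> cone_K \<alpha> \<beta> p R a b" "\<And>u. u \<in> S \<Longrightarrow> supnorm R u \<le> r"
  shows "bounded (H ` S)"
  using H_adm assms unfolding admissible_H_def by blast

text \<open>Real suprema and infima are informative only on bounded sets; the boundedness of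
  \<open>H\<close> on bounded sets provides this on the sphere.\<close>

lemma H_bdry:
  assumes "v \<in> K" "norm v = \<rho>"
  shows "H (J v) \<le> (SUP u\<in>bdry_K \<alpha> \<beta> p R a b \<rho>. H u)"
    and "(INF u\<in>bdry_K \<alpha> \<beta> p R a b \<rho>. H u) \<le> H (J v)"
proof -
  have "bounded (H ` bdry_K \<alpha> \<beta> p R a b \<rho>)"
    by (rule H_bounded[of _ \<rho>]) (auto simp: bdry_K_def)
  then show "H (J v) \<le> (SUP u\<in>bdry_K \<alpha> \<beta> p R a b \<rho>. H u)"
    and "(INF u\<in>bdry_K \<alpha> \<beta> p R a b \<rho>. H u) \<le> H (J v)"
    using J_in_bdry[OF assms]
    by (auto intro!: cSUP_upper cINF_lower bounded_imp_bdd_above bounded_imp_bdd_below)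
qed

end

section \<open>The Hammerstein operator for the truncated nonlinearity\<close>

context halfline_problem
begin

text \<open>Clamping from below makes the nonlinearity meaningful for negative arguments, clamping
  from above makes it bounded on compact time intervals.\<close>

definition ftrunc :: "real \<Rightarrow> real \<Rightarrow> real \<Rightarrow> real" where
  "ftrunc d t x = f t (max 0 (min d x))"

lemma ftrunc_cont:
  assumes "d \<ge> 0"
  shows "continuous_on ({0..} \<times> UNIV) (\<lambda>(t, x). ftrunc d t x)"
proof -
  have "continuous_on ({0..} \<times> UNIV) (\<lambda>z. case (fst z, max 0 (min d (snd z))) of (t, x) \<Rightarrow> f t x)"
    by (rule continuous_on_compose2[OF f_cont]) (auto intro!: continuous_intros)
  then show ?thesis
    by (simp add: ftrunc_def case_prod_beta)
qed

lemma ftrunc_bounded: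
  assumes "d \<ge> 0"
  shows "\<exists>B. \<forall>t\<in>{0..T}. \<forall>x. \<bar>ftrunc d t x\<bar> \<le> B"
proof -
  have "bounded ((\<lambda>(t, v). f t v) ` ({0..T} \<times> {0..d}))"
    by (intro compact_imp_bounded compact_continuous_image compact_Times continuous_on_subset[OF f_cont]) auto
  then obtain B where "\<And>t v. t \<in> {0..T} \<Longrightarrow> v \<in> {0..d} \<Longrightarrow> \<bar>f t v\<bar> \<le> B"
    by (force simp: bounded_iff)
  then show ?thesis
    using assms by (intro exI[of _ B]) (auto simp: ftrunc_def)
qed

lemma ftrunc_volterra: "d \<ge> 0 \<Longrightarrow> volterra_equation p (ftrunc d)"
  using p_cont p_pos ftrunc_cont ftrunc_bounded by unfold_locales

lemma ftrunc_nonneg: "t \<in> {0..R} \<Longrightarrow> ftrunc d t x \<ge> 0"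
  unfolding ftrunc_def by (rule f_nonneg) auto

text \<open>This is \<open>H / \<alpha>\<close> plus the integral of the kernel against the
  nonlinearity, with the common denominator \<open>\<alpha>\<close> taken out.\<close>

definition Y :: "real \<Rightarrow> (real \<Rightarrow>\<^sub>C real) \<Rightarrow> real \<Rightarrow> real" where
  "Y d v t = (H (J v) + integral {0..R} (\<lambda>s. \<Phi> (min s t) * ftrunc d s (apply_bcontfun v s))) / \<alpha>"

lemma \<Phi>_min_cont:
  assumes "t \<ge> 0"
  shows "continuous_on {0..R} (\<lambda>s. \<Phi> (min s t))"
  by (rule continuous_on_compose2[OF \<Phi>_cont]) (use assms in \<open>auto intro!: continuous_intros\<close>)

lemma ftrunc_comp_cont: "d \<ge> 0 \<Longrightarrow> S \<subseteq> {0..} \<Longrightarrow> continuous_on S (\<lambda>s. ftrunc d s (apply_bcontfun v s))"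
  using volterra_equation.g_comp_cont[OF ftrunc_volterra] by blast

lemma Y_integrand_cont:
  assumes "d \<ge> 0" "t \<ge> 0"
  shows "continuous_on {0..R} (\<lambda>s. \<Phi> (min s t) * ftrunc d s (apply_bcontfun v s))"
  using assms by (intro continuous_intros \<Phi>_min_cont ftrunc_comp_cont) auto

lemma Y_integrable:
  assumes "d \<ge> 0" "t \<ge> 0"
  shows "(\<lambda>s. \<Phi> (min s t) * ftrunc d s (apply_bcontfun v s)) integrable_on {0..R}"
  using Y_integrand_cont[OF assms] by (rule integrable_continuous_real)

lemma Y_nonneg:
  assumes "d \<ge> 0" "t \<ge> 0" "v \<in> K"
  shows "Y d v t \<ge> 0"
proof -
  have "integral {0..R} (\<lambda>s. \<Phi> (min s t) * ftrunc d s (apply_bcontfun v s)) \<ge> 0"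
    using assms by (intro integral_nonneg Y_integrable mult_nonneg_nonneg \<Phi>_nonneg ftrunc_nonneg) auto
  then show ?thesis
    using H_nonneg[OF assms(3)] \<alpha>_pos by (simp add: Y_def)
qed

lemma Y_mono:
  assumes "d \<ge> 0" "0 \<le> s" "s \<le> t"
  shows "Y d v s \<le> Y d v t"
proof -
  have "integral {0..R} (\<lambda>r. \<Phi> (min r s) * ftrunc d r (apply_bcontfun v r)) \<le>
      integral {0..R} (\<lambda>r. \<Phi> (min r t) * ftrunc d r (apply_bcontfun v r))"
    using assms by (intro integral_le Y_integrable mult_right_mono \<Phi>_mono ftrunc_nonneg) auto
  then show ?thesis
    using \<alpha>_pos by (simp add: Y_def divide_right_mono)
qed

text \<open>The kernel satisfies the same inequality pointwise: for \<open>r \<le> t\<close> because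
  \<open>c \<le> 1\<close> and \<open>\<Phi>\<close> increases, for \<open>r > t\<close> because
  \<open>c * \<Phi> R = \<Phi> a\<close>. The term with \<open>H\<close> is constant in time, so
  \<open>c \<le> 1\<close> suffices for it.\<close>

lemma Y_cone:
  assumes "d \<ge> 0" "t \<in> {a..b}" "s \<in> {0..R}" "v \<in> K"
  shows "c * Y d v s \<le> Y d v t"
proof -
  have *: "c * \<Phi> (min r s) \<le> \<Phi> (min r t)" if r: "r \<in> {0..R}" for r
  proof (cases "r \<le> t")
    case True
    have "c * \<Phi> (min r s) \<le> 1 * \<Phi> (min r s)"
      using c_le_1 r assms(3) by (intro mult_right_mono \<Phi>_nonneg) auto
    also have "\<dots> \<le> \<Phi> (min r t)"
      using True r assms by (auto intro!: \<Phi>_mono)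
    finally show ?thesis .
  next
    case False
    have "c * \<Phi> (min r s) \<le> c * \<Phi> R"
      using c_pos r assms(3) by (intro mult_left_mono \<Phi>_mono) auto
    also have "\<dots> = \<Phi> a"
      using \<Phi>_R_pos by (simp add: c_eq)
    also have "\<dots> \<le> \<Phi> (min r t)"
      using False assms ab by (intro \<Phi>_mono) auto
    finally show ?thesis .
  qed
  have "c * integral {0..R} (\<lambda>r. \<Phi> (min r s) * ftrunc d r (apply_bcontfun v r)) =
      integral {0..R} (\<lambda>r. c * (\<Phi> (min r s) * ftrunc d r (apply_bcontfun v r)))"
    by simp
  also have "\<dots> \<le> integral {0..R} (\<lambda>r. \<Phi> (min r t) * ftrunc d r (apply_bcontfun v r))"
  proof (rule integral_le)
    show "(\<lambda>r. c * (\<Phi> (min r s) * ftrunc d r (apply_bcontfun v r))) integrable_on {0..R}"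
      using assms by (intro integrable_continuous_real continuous_on_mult_left Y_integrand_cont) auto
    show "(\<lambda>r. \<Phi> (min r t) * ftrunc d r (apply_bcontfun v r)) integrable_on {0..R}"
      using assms ab by (intro Y_integrable) auto
    show "c * (\<Phi> (min r s) * ftrunc d r (apply_bcontfun v r)) \<le> \<Phi> (min r t) * ftrunc d r (apply_bcontfun v r)"
      if "r \<in> {0..R}" for r
      using mult_right_mono[OF *[OF that] ftrunc_nonneg[OF that]] by (simp add: mult.assoc)
  qed
  moreover have "c * H (J v) \<le> H (J v)"
    using H_nonneg[OF assms(4)] c_le_1 c_pos by (intro mult_left_le_one_le) auto
  ultimately have "c * (H (J v) + integral {0..R} (\<lambda>r. \<Phi> (min r s) * ftrunc d r (apply_bcontfun v r))) \<le>
      H (J v) + integral {0..R} (\<lambda>r. \<Phi> (min r t) * ftrunc d r (apply_bcontfun v r))"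
    by (simp add: distrib_left)
  then show ?thesis
    using \<alpha>_pos by (simp add: Y_def divide_right_mono)
qed

text \<open>The size bound needs a bound on the norm of \<open>v\<close>, on which the values of
  \<open>H\<close> depend. The Lipschitz constant does not, since the contribution of
  \<open>H\<close> cancels in differences.\<close>

lemma Y_bounds:
  assumes "d \<ge> 0"
  obtains Q L where "L \<ge> 0"
    "\<And>v t. v \<in> K \<Longrightarrow> norm v \<le> r \<Longrightarrow> t \<in> {0..R} \<Longrightarrow> \<bar>Y d v t\<bar> \<le> Q"
    "\<And>v s t. s \<in> {0..R} \<Longrightarrow> t \<in> {0..R} \<Longrightarrow> \<bar>Y d v s - Y d v t\<bar> \<le> L * \<bar>s - t\<bar>"
proof -
  obtain B where B: "\<And>t x. t \<in> {0..R} \<Longrightarrow> \<bar>ftrunc d t x\<bar> \<le> B"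
    using ftrunc_bounded[OF assms, of R] by blast
  have "B \<ge> 0"
    using B[of 0 0] R_pos by auto
  have "bounded (H ` {u \<in> cone_K \<alpha> \<beta> p R a b. supnorm R u \<le> r})"
    by (rule H_bounded) auto
  then obtain h where "\<And>u. u \<in> cone_K \<alpha> \<beta> p R a b \<Longrightarrow> supnorm R u \<le> r \<Longrightarrow> \<bar>H u\<bar> \<le> h"
    by (auto simp: bounded_iff)
  then have h: "\<bar>H (J v)\<bar> \<le> h" if "v \<in> K" "norm v \<le> r" for v
    using that by (simp add: J_in_cone norm_eq_supnorm)
  obtain q where q: "q > 0" "\<And>t. t \<in> {0..R} \<Longrightarrow> q \<le> p t"
    by (rule volterra_equation.p_lower[OF ftrunc_volterra[OF assms], of R]) (use R_pos in auto)
  have \<Phi>_lip: "\<bar>\<Phi> s - \<Phi> t\<bar> \<le> \<alpha> / q * \<bar>s - t\<bar>" if "s \<in> {0..R}" "t \<in> {0..R}" for s t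
  proof -
    have "\<bar>integral {0..s} (\<lambda>\<mu>. 1 / p \<mu>) - integral {0..t} (\<lambda>\<mu>. 1 / p \<mu>)\<bar> \<le> 1 / q * \<bar>s - t\<bar>"
    proof (rule integral_lipschitz[OF continuous_on_subset[OF inverse_p_cont] _ that])
      show "\<bar>1 / p \<mu>\<bar> \<le> 1 / q" if "\<mu> \<in> {0..R}" for \<mu>
        using q(1) q(2)[OF that] by (simp add: frac_le)
    qed auto
    from mult_left_mono[OF this, of \<alpha>] show ?thesis
      using \<alpha>_pos by (simp add: \<Phi>_def abs_mult right_diff_distrib[symmetric])
  qed
  have "\<bar>Y d v t\<bar> \<le> (h + \<Phi> R * B * R) / \<alpha>" if "v \<in> K" "norm v \<le> r" "t \<in> {0..R}" for v t
  proof -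
    have "norm (integral {0..R} (\<lambda>s. \<Phi> (min s t) * ftrunc d s (apply_bcontfun v s))) \<le> (\<Phi> R * B) * (R - 0)"
    proof (rule integral_bound)
      show "norm (\<Phi> (min s t) * ftrunc d s (apply_bcontfun v s)) \<le> \<Phi> R * B" if s: "s \<in> {0..R}" for s
        using B[OF s] \<open>B \<ge> 0\<close> s \<open>t \<in> {0..R}\<close> \<Phi>_nonneg[of "min s t"] \<Phi>_mono[of "min s t" R] \<Phi>_R_pos
        by (auto simp: abs_mult intro!: mult_mono)
    qed (use R_pos assms that in \<open>auto intro!: Y_integrand_cont\<close>)
    then have "\<bar>H (J v) + integral {0..R} (\<lambda>s. \<Phi> (min s t) * ftrunc d s (apply_bcontfun v s))\<bar> \<le> h + \<Phi> R * B * R"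
      using h[OF that(1,2)] by simp
    then show ?thesis
      using \<alpha>_pos by (simp add: Y_def abs_divide divide_right_mono)
  qed
  moreover have "\<bar>Y d v s - Y d v t\<bar> \<le> (B * R / q) * \<bar>s - t\<bar>" if st: "s \<in> {0..R}" "t \<in> {0..R}" for v s t
  proof -
    let ?D = "\<lambda>r. \<Phi> (min r s) * ftrunc d r (apply_bcontfun v r) - \<Phi> (min r t) * ftrunc d r (apply_bcontfun v r)"
    have "norm (integral {0..R} ?D) \<le> (\<alpha> / q * \<bar>s - t\<bar> * B) * (R - 0)"
    proof (rule integral_bound)
      show "continuous_on {0..R} ?D"
        using st assms by (intro continuous_on_diff Y_integrand_cont) auto
      show "norm (?D r) \<le> \<alpha> / q * \<bar>s - t\<bar> * B" if r: "r \<in> {0..R}" for r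
      proof -
        have "\<bar>\<Phi> (min r s) - \<Phi> (min r t)\<bar> \<le> \<alpha> / q * \<bar>min r s - min r t\<bar>"
          using r st by (intro \<Phi>_lip) auto
        also have "\<dots> \<le> \<alpha> / q * \<bar>s - t\<bar>"
          using \<alpha>_pos q(1) by (intro mult_left_mono) auto
        finally have "\<bar>\<Phi> (min r s) - \<Phi> (min r t)\<bar> * \<bar>ftrunc d r (apply_bcontfun v r)\<bar> \<le> \<alpha> / q * \<bar>s - t\<bar> * B"
          using B[OF r] \<alpha>_pos q(1) by (intro mult_mono) auto
        then show ?thesis
          by (simp add: left_diff_distrib[symmetric] abs_mult)
      qed
    qed (use R_pos in simp)
    moreover have "Y d v s - Y d v t = integral {0..R} ?D / \<alpha>"
      using assms st by (subst integral_diff) (auto simp: Y_def diff_divide_distrib add_divide_distrib intro!: Y_integrable)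
    ultimately show ?thesis
      using \<alpha>_pos by (simp add: abs_divide pos_divide_le_eq mult_ac)
  qed
  moreover have "B * R / q \<ge> 0"
    using \<open>B \<ge> 0\<close> q R_pos by simp
  ultimately show ?thesis
    using that by blast
qed

definition T :: "real \<Rightarrow> (real \<Rightarrow>\<^sub>C real) \<Rightarrow> (real \<Rightarrow>\<^sub>C real)" where
  "T d v = clamp_ext 0 R (Y d v)"

lemma Y_cont:
  assumes "d \<ge> 0"
  shows "continuous_on {0..R} (Y d v)"
proof -
  obtain L where "L \<ge> 0" "\<And>s t. s \<in> {0..R} \<Longrightarrow> t \<in> {0..R} \<Longrightarrow> \<bar>Y d v s - Y d v t\<bar> \<le> L * \<bar>s - t\<bar>"
    using Y_bounds[OF assms] by metis
  then have "L-lipschitz_on {0..R} (Y d v)"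
    by (auto simp: lipschitz_on_def dist_real_def)
  then show ?thesis
    by (rule lipschitz_on_continuous_on)
qed

lemma T_apply: "d \<ge> 0 \<Longrightarrow> apply_bcontfun (T d v) t = Y d v (max 0 (min R t))"
  unfolding T_def using R_pos Y_cont by (intro clamp_ext_apply) auto

lemma T_in_K:
  assumes "d \<ge> 0" "v \<in> K"
  shows "T d v \<in> K"
proof -
  have "c * norm (T d v) \<le> apply_bcontfun (T d v) t" if t: "t \<in> {a..b}" for t
  proof -
    \<comment> \<open>The cone inequality at this one \<open>t\<close> bounds the values at all
      other points.\<close>
    have "norm (T d v) \<le> Y d v t / c"
    proof (rule norm_bound)
      fix s
      have "max 0 (min R s) \<in> {0..R}"
        using R_pos by auto
      from Y_cone[OF assms(1) t this assms(2)] Y_nonneg[OF assms(1) _ assms(2), of "max 0 (min R s)"]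
      show "norm (apply_bcontfun (T d v) s) \<le> Y d v t / c"
        using c_pos by (simp add: T_apply[OF assms(1)] pos_le_divide_eq mult.commute)
    qed
    moreover have "max 0 (min R t) = t"
      using t ab by auto
    ultimately show ?thesis
      using c_pos by (simp add: T_apply[OF assms(1)] pos_le_divide_eq mult.commute)
  qed
  moreover have "max 0 (min R (max 0 (min R t))) = max 0 (min R t)" for t
    using R_pos by auto
  ultimately show ?thesis
    using Y_nonneg[OF assms(1) _ assms(2)] by (simp add: K_def T_apply[OF assms(1)])
qed

lemma T_cont:
  assumes "d \<ge> 0"
  shows "continuous_on K (T d)"
  unfolding continuous_on_iff
proof (intro ballI allI impI)
  fix v and \<epsilon> :: real assume v: "v \<in> K" and "\<epsilon> > 0"
  \<comment> \<open>Chosen so that the integral contributes at most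
    \<open>\<alpha> * \<epsilon> / 4\<close>; \<open>H\<close> contributes as much, and the division
    by \<open>\<alpha>\<close> leaves \<open>\<epsilon> / 2\<close>.\<close>
  define \<eta> where "\<eta> = \<alpha> * \<epsilon> / (4 * (\<Phi> R * R))"
  have pos: "\<Phi> R * R > 0" "\<alpha> * \<epsilon> / 4 > 0"
    using \<Phi>_R_pos R_pos \<alpha>_pos \<open>\<epsilon> > 0\<close> by auto
  then have "\<eta> > 0"
    by (simp add: \<eta>_def)
  have "continuous_on ({0..R} \<times> UNIV) (\<lambda>(t, x). ftrunc d t x)"
    by (rule continuous_on_subset[OF ftrunc_cont[OF assms]]) auto
  then obtain \<delta>1 where \<delta>1: "\<delta>1 > 0" "\<And>w s. dist w v < \<delta>1 \<Longrightarrow> s \<in> {0..R} \<Longrightarrow>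
      \<bar>ftrunc d s (apply_bcontfun w s) - ftrunc d s (apply_bcontfun v s)\<bar> < \<eta>"
    using superposition_continuous[OF _ \<open>\<eta> > 0\<close>] by blast
  obtain \<delta>2 where \<delta>2: "\<delta>2 > 0" "\<And>w. w \<in> K \<Longrightarrow> dist w v < \<delta>2 \<Longrightarrow> \<bar>H (J w) - H (J v)\<bar> < \<alpha> * \<epsilon> / 4"
    using HJ_cont v pos(2) unfolding continuous_on_iff dist_real_def by metis
  have "dist (T d w) (T d v) \<le> \<epsilon> / 2" if w: "w \<in> K" "dist w v < min \<delta>1 \<delta>2" for w
  proof (rule dist_bound)
    fix t'
    define t where "t = max 0 (min R t')"
    have t: "t \<in> {0..R}"
      using R_pos by (auto simp: t_def)
    let ?D = "\<lambda>s. \<Phi> (min s t) * ftrunc d s (apply_bcontfun w s) - \<Phi> (min s t) * ftrunc d s (apply_bcontfun v s)"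
    have "norm (integral {0..R} ?D) \<le> (\<Phi> R * \<eta>) * (R - 0)"
    proof (rule integral_bound)
      show "continuous_on {0..R} ?D"
        using t assms by (intro continuous_on_diff Y_integrand_cont) auto
      show "norm (?D s) \<le> \<Phi> R * \<eta>" if s: "s \<in> {0..R}" for s
      proof -
        have "\<bar>\<Phi> (min s t)\<bar> * \<bar>ftrunc d s (apply_bcontfun w s) - ftrunc d s (apply_bcontfun v s)\<bar> \<le> \<Phi> R * \<eta>"
          using \<delta>1(2)[of w s] w s t \<Phi>_nonneg[of "min s t"] \<Phi>_mono[of "min s t" R] \<Phi>_R_pos
          by (intro mult_mono) auto
        then show ?thesis
          by (simp add: right_diff_distrib[symmetric] abs_mult)
      qed
    qed (use R_pos in simp)
    also have "(\<Phi> R * \<eta>) * (R - 0) = \<alpha> * \<epsilon> / 4"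
      using \<Phi>_R_pos R_pos by (simp add: \<eta>_def)
    finally have "\<bar>integral {0..R} ?D\<bar> \<le> \<alpha> * \<epsilon> / 4"
      by simp
    moreover have Y_diff: "Y d w t - Y d v t = (H (J w) - H (J v) + integral {0..R} ?D) / \<alpha>"
      using assms t by (subst integral_diff) (auto simp: Y_def diff_divide_distrib add_divide_distrib intro!: Y_integrable)
    moreover have "\<bar>H (J w) - H (J v)\<bar> < \<alpha> * \<epsilon> / 4"
      using \<delta>2(2) w by simp
    ultimately have "\<bar>H (J w) - H (J v) + integral {0..R} ?D\<bar> \<le> \<alpha> * \<epsilon> / 2"
      by (intro order_trans[OF abs_triangle_ineq]) linarith
    then have "\<bar>Y d w t - Y d v t\<bar> \<le> (\<alpha> * \<epsilon> / 2) / \<alpha>"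
      unfolding Y_diff using \<alpha>_pos by (simp only: abs_divide abs_of_pos divide_right_mono less_imp_le)
    then show "dist (apply_bcontfun (T d w) t') (apply_bcontfun (T d v) t') \<le> \<epsilon> / 2"
      using \<alpha>_pos by (simp add: T_apply[OF assms] t_def dist_real_def)
  qed
  then show "\<exists>\<delta>>0. \<forall>w\<in>K. dist w v < \<delta> \<longrightarrow> dist (T d w) (T d v) < \<epsilon>"
    using \<delta>1(1) \<delta>2(1) \<open>\<epsilon> > 0\<close> by (intro exI[of _ "min \<delta>1 \<delta>2"]) force
qed

lemma closed_K: "closed K"
proof -
  have ev: "continuous_on UNIV (\<lambda>v :: real \<Rightarrow>\<^sub>C real. apply_bcontfun v t)" for t
    unfolding continuous_on_iff using dist_fun_lt_imp_dist_val_lt by blast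
  show ?thesis
    unfolding K_def
    by (intro closed_Collect_conj closed_Collect_all closed_Collect_eq closed_Collect_le ev continuous_intros)
      (auto simp: Ball_def intro!: closed_Collect_all closed_Collect_imp closed_Collect_le ev continuous_intros)
qed

lemma T_compact:
  assumes "d \<ge> 0"
  obtains C where "compact C" "C \<subseteq> K" "T d ` {v \<in> K. norm v \<le> r} \<subseteq> C"
proof -
  obtain Q L where L: "L \<ge> 0"
    "\<And>v t. v \<in> K \<Longrightarrow> norm v \<le> r \<Longrightarrow> t \<in> {0..R} \<Longrightarrow> \<bar>Y d v t\<bar> \<le> Q"
    "\<And>v s t. s \<in> {0..R} \<Longrightarrow> t \<in> {0..R} \<Longrightarrow> \<bar>Y d v s - Y d v t\<bar> \<le> L * \<bar>s - t\<bar>"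
    by (rule Y_bounds[OF assms, of r]) (rule that; assumption)
  have "T d v \<in> lipschitz_fns 0 R Q L" if "v \<in> K" "norm v \<le> r" for v
    unfolding T_def using that R_pos by (intro clamp_ext_in_lipschitz_fns L) auto
  moreover have "compact (lipschitz_fns 0 R Q L \<inter> K)"
    using R_pos L(1) by (intro compact_Int_closed compact_lipschitz_fns closed_K) auto
  ultimately show ?thesis
    using that[of "lipschitz_fns 0 R Q L \<inter> K"] T_in_K[OF assms] by blast
qed

section \<open>Norm estimates on spheres and existence of fixed points\<close>

lemma kernel_integrable:
  assumes "0 \<le> l" "r \<le> R" "t \<ge> 0"
  shows "(\<lambda>s. \<Phi> (min s t)) integrable_on {l..r}"
  using assms by (intro integrable_continuous_real continuous_on_subset[OF \<Phi>_min_cont]) auto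

text \<open>On the sphere of radius \<open>\<rho> \<le> d\<close> the truncation is inactive, and on
  \<open>{a..b}\<close> the cone condition confines the values to
  \<open>{c * \<rho>..\<rho>}\<close>.\<close>

lemma f_apply_bounds:
  assumes "v \<in> K" "norm v = \<rho>" "\<rho> \<le> d" "s \<in> {0..R}"
  shows "ftrunc d s (apply_bcontfun v s) \<le> (SUP (t, v)\<in>{0..R} \<times> {0..\<rho>}. f t v)"
    and "s \<in> {a..b} \<Longrightarrow> (INF (t, v)\<in>{a..b} \<times> {c * \<rho>..\<rho>}. f t v) \<le> ftrunc d s (apply_bcontfun v s)"
proof -
  have v: "0 \<le> apply_bcontfun v s" "apply_bcontfun v s \<le> \<rho>"
    using K_nonneg[OF assms(1)] norm_bounded[of v s] assms(2) by auto
  then have f: "ftrunc d s (apply_bcontfun v s) = (\<lambda>(t, v). f t v) (s, apply_bcontfun v s)"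
    using assms by (simp add: ftrunc_def)
  have bdd: "bounded ((\<lambda>(t, v). f t v) ` ({0..R} \<times> {0..\<rho>}))"
    by (intro compact_imp_bounded compact_continuous_image compact_Times continuous_on_subset[OF f_cont]) auto
  show "ftrunc d s (apply_bcontfun v s) \<le> (SUP (t, v)\<in>{0..R} \<times> {0..\<rho>}. f t v)"
    unfolding f using bdd v assms by (intro cSUP_upper bounded_imp_bdd_above) auto
  assume s: "s \<in> {a..b}"
  have "\<rho> \<ge> 0"
    using v by linarith
  then have "0 \<le> c * \<rho>"
    using c_pos by simp
  then have "{a..b} \<times> {c * \<rho>..\<rho>} \<subseteq> {0..R} \<times> {0..\<rho>}"
    using ab by auto
  then have "bounded ((\<lambda>(t, v). f t v) ` ({a..b} \<times> {c * \<rho>..\<rho>}))"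
    using bdd by (meson bounded_subset image_mono)
  then show "(INF (t, v)\<in>{a..b} \<times> {c * \<rho>..\<rho>}. f t v) \<le> ftrunc d s (apply_bcontfun v s)"
    unfolding f using v s K_lower[OF assms(1) s] assms(2)
    by (intro cINF_lower bounded_imp_bdd_below) auto
qed

text \<open>Replacing the nonlinearity and \<open>H\<close> by their largest values bounds all
  values of the operator by the left-hand side of the condition.\<close>

lemma T_contracts:
  assumes v: "v \<in> K" "norm v = \<rho>" and "\<rho> \<le> d" and I1: "cond_I1 \<alpha> \<beta> p R a b f H \<rho>"
  shows "norm (T d v) < \<rho>"
proof -
  have "\<rho> \<ge> 0"
    using v(2) by auto
  then have "d \<ge> 0"
    using assms by simp
  define F where "F = (SUP (t, v)\<in>{0..R} \<times> {0..\<rho>}. f t v)"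
  define h where "h = (SUP u\<in>bdry_K \<alpha> \<beta> p R a b \<rho>. H u)"
  have fF: "ftrunc d s (apply_bcontfun v s) \<le> F" if "s \<in> {0..R}" for s
    unfolding F_def by (rule f_apply_bounds[OF v \<open>\<rho> \<le> d\<close> that])
  have "F \<ge> 0"
    using fF[of 0] ftrunc_nonneg[of 0 d "apply_bcontfun v 0"] R_pos by auto
  let ?k = "\<lambda>t. integral {0..R} (\<lambda>s. kernel_k \<alpha> \<beta> p t s)"
  have k: "?k t = integral {0..R} (\<lambda>s. \<Phi> (min s t)) / \<alpha>" for t
    by (simp add: kernel_eq)
  \<comment> \<open>Bounds the set of kernel integrals, so that its supremum dominates each of
    them.\<close>
  have k_mono: "?k t \<le> ?k R" if "t \<in> {0..R}" for t
    unfolding k using that R_pos \<alpha>_pos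
    by (intro divide_right_mono integral_le kernel_integrable \<Phi>_mono) auto
  have "Y d v t \<le> 1 / m_const \<alpha> \<beta> p R * F + 1 / \<alpha> * h" if t: "t \<in> {0..R}" for t
  proof -
    have "integral {0..R} (\<lambda>s. \<Phi> (min s t) * ftrunc d s (apply_bcontfun v s)) \<le>
        integral {0..R} (\<lambda>s. \<Phi> (min s t) * F)"
      using t fF \<open>d \<ge> 0\<close>
      by (intro integral_le Y_integrable mult_left_mono \<Phi>_nonneg integrable_continuous_real
          continuous_on_mult_right \<Phi>_min_cont) auto
    also have "\<dots> = \<alpha> * (?k t * F)"
      using \<alpha>_pos by (simp add: k)
    also have "\<dots> \<le> \<alpha> * (1 / m_const \<alpha> \<beta> p R * F)"
    proof -
      have "?k t \<le> (SUP t\<in>{0..R}. ?k t)"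
        using k_mono t by (intro cSUP_upper bdd_aboveI2[where M="?k R"]) auto
      then show ?thesis
        using \<alpha>_pos \<open>F \<ge> 0\<close> by (intro mult_left_mono mult_right_mono) (auto simp: m_const_def)
    qed
    finally have "H (J v) + integral {0..R} (\<lambda>s. \<Phi> (min s t) * ftrunc d s (apply_bcontfun v s)) \<le>
        h + \<alpha> * (1 / m_const \<alpha> \<beta> p R * F)"
      using H_bdry(1)[OF v] by (simp add: h_def)
    then have "Y d v t \<le> (h + \<alpha> * (1 / m_const \<alpha> \<beta> p R * F)) / \<alpha>"
      unfolding Y_def using \<alpha>_pos by (intro divide_right_mono) auto
    also have "\<dots> = 1 / m_const \<alpha> \<beta> p R * F + 1 / \<alpha> * h"
      using \<alpha>_pos by (simp add: add_divide_distrib)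
    finally show ?thesis .
  qed
  then have "norm (T d v) \<le> 1 / m_const \<alpha> \<beta> p R * F + 1 / \<alpha> * h"
    using Y_nonneg[OF \<open>d \<ge> 0\<close> _ v(1)] R_pos
    by (intro norm_bound) (simp add: T_apply[OF \<open>d \<ge> 0\<close>])
  also have "\<dots> < \<rho>"
    using I1 by (simp add: cond_I1_def F_def h_def)
  finally show ?thesis .
qed

text \<open>A single value already exceeds \<open>\<rho>\<close>: the one at \<open>t = a\<close>.
  The integral is cut down to \<open>{a..b}\<close>, where the lower bound for the nonlinearity
  holds; nonnegativity permits this.\<close>

lemma T_expands:
  assumes v: "v \<in> K" "norm v = \<rho>" and "\<rho> \<le> d" and I0: "cond_I0 \<alpha> \<beta> p R a b f H \<rho>"
  shows "norm (T d v) > \<rho>"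
proof -
  have "\<rho> \<ge> 0"
    using v(2) by auto
  then have "d \<ge> 0"
    using assms by simp
  define F where "F = (INF (t, v)\<in>{a..b} \<times> {c * \<rho>..\<rho>}. f t v)"
  define h where "h = (INF u\<in>bdry_K \<alpha> \<beta> p R a b \<rho>. H u)"
  have fF: "F \<le> ftrunc d s (apply_bcontfun v s)" if "s \<in> {a..b}" for s
    unfolding F_def by (rule f_apply_bounds[OF v \<open>\<rho> \<le> d\<close>]) (use that ab in auto)
  have "c * \<rho> \<le> \<rho>"
    using c_le_1 c_pos \<open>\<rho> \<ge> 0\<close> by (intro mult_left_le_one_le) auto
  moreover have "f t x \<ge> 0" if "t \<in> {a..b}" "x \<ge> c * \<rho>" for t x
    using that ab c_pos \<open>\<rho> \<ge> 0\<close> by (intro f_nonneg) (auto intro: order_trans[of 0 "c * \<rho>"])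
  ultimately have "F \<ge> 0"
    unfolding F_def using ab by (intro cINF_greatest) auto
  let ?k = "\<lambda>t. integral {a..b} (\<lambda>s. kernel_k \<alpha> \<beta> p t s)"
  have k: "?k t = integral {a..b} (\<lambda>s. \<Phi> (min s t)) / \<alpha>" for t
    by (simp add: kernel_eq)
  have k_nonneg: "0 \<le> ?k t" if "t \<in> {a..b}" for t
    unfolding k using that ab \<alpha>_pos
    by (intro divide_nonneg_pos integral_nonneg kernel_integrable \<Phi>_nonneg) auto
  have "\<alpha> * (1 / M_const \<alpha> \<beta> p a b * F) \<le> \<alpha> * (?k a * F)"
  proof -
    have "(INF t\<in>{a..b}. ?k t) \<le> ?k a"
      using k_nonneg ab by (intro cINF_lower bdd_belowI2[where m=0]) auto
    then show ?thesis
      using \<alpha>_pos \<open>F \<ge> 0\<close> by (intro mult_left_mono mult_right_mono) (auto simp: M_const_def)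
  qed
  also have "\<dots> = integral {a..b} (\<lambda>s. \<Phi> (min s a) * F)"
    using \<alpha>_pos by (simp add: k)
  also have "\<dots> \<le> integral {a..b} (\<lambda>s. \<Phi> (min s a) * ftrunc d s (apply_bcontfun v s))"
    using ab fF \<open>d \<ge> 0\<close>
    by (intro integral_le mult_left_mono \<Phi>_nonneg integrable_continuous_real continuous_on_mult_right
        continuous_on_subset[OF \<Phi>_min_cont] continuous_on_subset[OF Y_integrand_cont]) auto
  also have "\<dots> \<le> integral {0..R} (\<lambda>s. \<Phi> (min s a) * ftrunc d s (apply_bcontfun v s))"
    using ab \<open>d \<ge> 0\<close>
    by (intro integral_subset_le Y_integrable integrable_continuous_real
        continuous_on_subset[OF Y_integrand_cont]) (auto intro!: mult_nonneg_nonneg \<Phi>_nonneg ftrunc_nonneg)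
  finally have "h + \<alpha> * (1 / M_const \<alpha> \<beta> p a b * F) \<le>
      H (J v) + integral {0..R} (\<lambda>s. \<Phi> (min s a) * ftrunc d s (apply_bcontfun v s))"
    using H_bdry(2)[OF v] by (simp add: h_def)
  then have "(h + \<alpha> * (1 / M_const \<alpha> \<beta> p a b * F)) / \<alpha> \<le> Y d v a"
    unfolding Y_def using \<alpha>_pos by (intro divide_right_mono) auto
  moreover have "(h + \<alpha> * (1 / M_const \<alpha> \<beta> p a b * F)) / \<alpha> = 1 / M_const \<alpha> \<beta> p a b * F + 1 / \<alpha> * h"
    using \<alpha>_pos by (simp add: add_divide_distrib)
  moreover have "\<dots> > \<rho>"
    using I0 by (simp add: cond_I0_def F_def h_def)
  moreover have "Y d v a \<le> norm (T d v)"
    using norm_bounded[of "T d v" a] ab by (simp add: T_apply[OF \<open>d \<ge> 0\<close>])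
  ultimately show ?thesis
    by linarith
qed

lemma fixed_point_exists:
  assumes r: "0 < \<rho>1" "\<rho>1 < \<rho>2" "\<rho>2 \<le> d"
    and I: "(cond_I0 \<alpha> \<beta> p R a b f H \<rho>1 \<and> cond_I1 \<alpha> \<beta> p R a b f H \<rho>2) \<or>
      (cond_I1 \<alpha> \<beta> p R a b f H \<rho>1 \<and> cond_I0 \<alpha> \<beta> p R a b f H \<rho>2)"
  obtains v where "v \<in> K" "\<rho>1 < norm v" "norm v < \<rho>2" "T d v = v"
proof -
  have "d \<ge> 0" "\<rho>1 \<le> d"
    using r by auto
  obtain C where C: "compact C" "C \<subseteq> K" "T d ` {v \<in> K. norm v \<le> \<rho>2} \<subseteq> C"
    by (rule T_compact[OF \<open>d \<ge> 0\<close>, of \<rho>2]) (rule that; assumption)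
  have sub: "cone.annulus \<rho>1 \<rho>2 \<subseteq> {v \<in> K. norm v \<le> \<rho>2}"
    by (auto simp: cone.annulus_def)
  then have cont: "continuous_on (cone.annulus \<rho>1 \<rho>2) (T d)"
    by (intro continuous_on_subset[OF T_cont[OF \<open>d \<ge> 0\<close>]]) auto
  have img: "T d ` cone.annulus \<rho>1 \<rho>2 \<subseteq> C"
    using C(3) sub by blast
  from I show ?thesis
  proof
    assume I: "cond_I0 \<alpha> \<beta> p R a b f H \<rho>1 \<and> cond_I1 \<alpha> \<beta> p R a b f H \<rho>2"
    show ?thesis
    proof (rule cone.cone_compression[OF r(1,2) cont C(1,2) img])
      show "norm (T d x) > \<rho>1" if "x \<in> K" "norm x = \<rho>1" for x
        using T_expands[OF that \<open>\<rho>1 \<le> d\<close>] I by simp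
      show "norm (T d x) < \<rho>2" if "x \<in> K" "norm x = \<rho>2" for x
        using T_contracts[OF that r(3)] I by simp
    qed (rule that)
  next
    assume I: "cond_I1 \<alpha> \<beta> p R a b f H \<rho>1 \<and> cond_I0 \<alpha> \<beta> p R a b f H \<rho>2"
    show ?thesis
    proof (rule cone.cone_expansion[OF r(1,2) cont C(1,2) img])
      show "norm (T d x) < \<rho>1" if "x \<in> K" "norm x = \<rho>1" for x
        using T_contracts[OF that \<open>\<rho>1 \<le> d\<close>] I by simp
      show "norm (T d x) > \<rho>2" if "x \<in> K" "norm x = \<rho>2" for x
        using T_expands[OF that r(3)] I by simp
    qed (rule that)
  qed
qed

text \<open>The value \<open>q0\<close> is the full integral over \<open>{0..R}\<close>, so that the
  momentum vanishes at \<open>R\<close>. The kernel integral is rewritten as an iterated integral,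
  which turns the Hammerstein equation into the Volterra form used for continuation.\<close>

lemma fixed_point_volterra:
  assumes "d \<ge> 0" "v \<in> K" "T d v = v"
  defines "q0 \<equiv> integral {0..R} (\<lambda>s. ftrunc d s (apply_bcontfun v s))"
  shows "t \<in> {0..R} \<Longrightarrow> apply_bcontfun v t =
      volterra p (ftrunc d) (apply_bcontfun v 0) q0 (apply_bcontfun v) t"
    and "\<alpha> * apply_bcontfun v 0 - \<beta> * (q0 / p 0) = H (J v)"
    and "apply_bcontfun v R = norm v"
proof -
  interpret V: volterra_equation p "ftrunc d"
    by (rule ftrunc_volterra[OF assms(1)])
  let ?v = "apply_bcontfun v"
  let ?G = "\<lambda>s. ftrunc d s (?v s)"
  let ?m = "momentum (ftrunc d) q0 ?v"
  \<comment> \<open>Constancy of \<open>D\<close> replaces an exchange of integrations: by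
    \<open>\<Phi>' = \<alpha> / p\<close> and \<open>?m' = - ?G\<close> all terms of its derivative
    cancel.\<close>
  define D where "D t = integral {0..t} (\<lambda>s. \<Phi> s * ?G s) + \<Phi> t * ?m t - \<alpha> * integral {0..t} (\<lambda>s. ?m s / p s)" for t
  have G: "continuous_on {0..} ?G"
    by (rule ftrunc_comp_cont[OF assms(1)]) simp
  have m': "(?m has_real_derivative - ?G t) (at t within {0..})" if "t \<ge> 0" for t
    unfolding momentum_def
    using DERIV_diff[OF DERIV_const integral_upper_halfline_derivative[OF G that]] by simp
  have m: "continuous_on {0..} ?m"
    using m' by (intro DERIV_continuous_on) auto
  have mp: "continuous_on {0..} (\<lambda>s. ?m s / p s)"
    by (intro continuous_intros m p_cont) (auto simp: p_nonzero)
  have "(D has_real_derivative 0) (at t within {0..})" if "t \<in> {0..}" for t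
  proof -
    have "t \<ge> 0"
      using that by simp
    note [derivative_intros] =
      integral_upper_halfline_derivative[OF continuous_on_mult[OF \<Phi>_cont G] \<open>t \<ge> 0\<close>]
      integral_upper_halfline_derivative[OF mp \<open>t \<ge> 0\<close>] \<Phi>_deriv[OF \<open>t \<ge> 0\<close>] m'[OF \<open>t \<ge> 0\<close>]
    show ?thesis
      unfolding D_def by (rule derivative_eq_intros refl)+ (simp add: algebra_simps)
  qed
  then obtain C where "\<And>t. t \<ge> 0 \<Longrightarrow> D t = C"
    using has_field_derivative_zero_constant[of "{0..}" D] by auto
  then have D: "D t = \<Phi> 0 * q0" if "t \<ge> 0" for t
    using that by (simp add: D_def[of 0] momentum_def flip: \<open>\<And>t. t \<ge> 0 \<Longrightarrow> D t = C\<close>[of 0])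
  have kernel: "integral {0..R} (\<lambda>s. \<Phi> (min s t) * ?G s) = \<Phi> 0 * q0 + \<alpha> * integral {0..t} (\<lambda>s. ?m s / p s)"
    if t: "t \<in> {0..R}" for t
  proof -
    have "?G integrable_on {0..R}"
      by (intro integrable_continuous_real continuous_on_subset[OF G]) auto
    then have "integral {0..t} ?G + integral {t..R} ?G = q0"
      unfolding q0_def using t by (intro Henstock_Kurzweil_Integration.integral_combine) auto
    \<comment> \<open>The part of the kernel beyond \<open>t\<close> has constant factor
      \<open>\<Phi> t\<close>, and what it multiplies is precisely the momentum at
      \<open>t\<close>.\<close>
    then have mt: "integral {t..R} ?G = ?m t"
      by (simp add: momentum_def)
    have "integral {0..R} (\<lambda>s. \<Phi> (min s t) * ?G s) =
        integral {0..t} (\<lambda>s. \<Phi> (min s t) * ?G s) + integral {t..R} (\<lambda>s. \<Phi> (min s t) * ?G s)"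
      using t by (intro Henstock_Kurzweil_Integration.integral_combine[symmetric] Y_integrable assms) auto
    also have "integral {0..t} (\<lambda>s. \<Phi> (min s t) * ?G s) = integral {0..t} (\<lambda>s. \<Phi> s * ?G s)"
      by (rule integral_cong) auto
    also have "integral {t..R} (\<lambda>s. \<Phi> (min s t) * ?G s) = integral {t..R} (\<lambda>s. \<Phi> t * ?G s)"
      by (rule integral_cong) (auto simp: min_absorb2)
    also have "integral {t..R} (\<lambda>s. \<Phi> t * ?G s) = \<Phi> t * ?m t"
      by (simp add: mt)
    finally show ?thesis
      using D[of t] t by (simp add: D_def)
  qed
  have v: "?v t = (H (J v) + \<Phi> 0 * q0 + \<alpha> * integral {0..t} (\<lambda>s. ?m s / p s)) / \<alpha>" if t: "t \<in> {0..R}" for t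
    using T_apply[OF assms(1), of v t] t kernel[OF t] by (simp add: assms(3) Y_def)
  have v0: "?v 0 = (H (J v) + \<Phi> 0 * q0) / \<alpha>"
    using v[of 0] R_pos by simp
  show "?v t = volterra p (ftrunc d) (?v 0) q0 ?v t" if "t \<in> {0..R}" for t
    using v[OF that] \<alpha>_pos unfolding v0 volterra_def by (simp add: add_divide_distrib)
  show "\<alpha> * ?v 0 - \<beta> * (q0 / p 0) = H (J v)"
    using \<alpha>_pos by (simp add: v0 \<Phi>_0)
  show "?v R = norm v"
  proof (rule antisym)
    show "?v R \<le> norm v"
      using norm_bounded[of v R] by simp
    have vt: "?v t = Y d v (max 0 (min R t))" for t
      using T_apply[OF assms(1), of v t] by (simp add: assms(3))
    show "norm v \<le> ?v R"
    proof (rule norm_bound)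
      fix t
      have "Y d v (max 0 (min R t)) \<le> Y d v (max 0 (min R R))"
        using R_pos by (intro Y_mono assms) auto
      then show "norm (?v t) \<le> ?v R"
        using K_nonneg[OF assms(2), of t] by (simp add: vt)
    qed
  qed
qed

end

section \<open>A priori bounds on the half-line\<close>

text \<open>After the last point where \<open>W\<close> is nonnegative it would be negative, hence
  nondecreasing, and so could not have become negative. Information on the derivative is needed only
  where \<open>W\<close> is negative.\<close>

lemma nonneg_barrier:
  fixes W :: "real \<Rightarrow> real"
  assumes "l \<le> r" and cont: "continuous_on {l..r} W" and "W l \<ge> 0"
    and deriv: "\<And>t. l < t \<Longrightarrow> t < r \<Longrightarrow> W t < 0 \<Longrightarrow> \<exists>y\<ge>0. (W has_real_derivative y) (at t)"
  shows "W r \<ge> 0"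
proof (rule ccontr)
  assume neg: "\<not> W r \<ge> 0"
  define S where "S = {l..r} \<inter> W -` {0..}"
  have "closed S"
    unfolding S_def by (intro continuous_closed_preimage cont) auto
  moreover have "bounded S"
    unfolding S_def by (rule bounded_subset[OF bounded_closed_interval[of l r]]) auto
  ultimately have "compact S"
    by (simp add: compact_eq_bounded_closed)
  moreover have "l \<in> S"
    using assms by (simp add: S_def)
  ultimately obtain m where m: "m \<in> S" "\<And>s. s \<in> S \<Longrightarrow> s \<le> m"
    using compact_attains_sup[of S] by blast
  have "m \<in> {l..r}" "W m \<ge> 0"
    using m(1) by (auto simp: S_def)
  have "W m \<le> W r"
  proof (rule DERIV_nonneg_imp_increasing_open[of m r W])
    fix t assume t: "m < t" "t < r"
    then have "W t < 0"
      using m(2)[of t] \<open>m \<in> {l..r}\<close> by (force simp: S_def)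
    then show "\<exists>y. (W has_real_derivative y) (at t) \<and> 0 \<le> y"
      using deriv[of t] t \<open>m \<in> {l..r}\<close> by auto
  qed (use \<open>m \<in> {l..r}\<close> in \<open>auto intro: continuous_on_subset[OF cont]\<close>)
  with \<open>W m \<ge> 0\<close> neg show False
    by simp
qed

lemma at_within_halfline: "l < t \<Longrightarrow> at t within {l..} = at t" for t :: real
  by (intro at_within_interior) auto

lemma halfline_nondecreasing:
  fixes W :: "real \<Rightarrow> real"
  assumes "\<And>t. t \<ge> l \<Longrightarrow> (W has_real_derivative W' t) (at t within {l..})"
    and "\<And>t. l < t \<Longrightarrow> t < r \<Longrightarrow> W' t \<ge> 0" and "l \<le> r"
  shows "W l \<le> W r"
proof (rule DERIV_nonneg_imp_increasing_open[OF \<open>l \<le> r\<close>])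
  show "\<exists>y. (W has_real_derivative y) (at t) \<and> 0 \<le> y" if "l < t" "t < r" for t
    using assms(1)[of t] assms(2)[OF that] that at_within_halfline[of l t] by auto
  have "continuous_on {l..} W"
    using assms(1) by (intro DERIV_continuous_on) auto
  then show "continuous_on {l..r} W"
    by (rule continuous_on_subset) auto
qed

text \<open>
  Comparison with the Euler equation \<open>(t\<^sup>n z')' + \<lambda>\<^sup>2 t\<^bsup>n-2\<^esup> z = 0\<close>, whose positive solution is
  \<open>t\<^bsup>-\<lambda>\<^esup>\<close>: as long as \<open>u \<ge> 0\<close>, the quantity \<open>q + \<lambda> t\<^bsup>n-1\<^esup> u\<close> is nonnegative,
  so that \<open>t\<^bsup>\<lambda>\<^esup> u\<close> is nondecreasing.
\<close>

lemma euler_comparison_pos: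
  fixes u q p h :: "real \<Rightarrow> real"
  assumes "R > 0" and "n > 1" and lam: "lam = (n - 1) / 2"
    and u': "\<And>t. t \<ge> R \<Longrightarrow> (u has_real_derivative q t / p t) (at t within {R..})"
    and q': "\<And>t. t \<ge> R \<Longrightarrow> (q has_real_derivative - h t) (at t within {R..})"
    and "q R = 0" and "u R > 0"
    and p: "\<And>t. t \<ge> R \<Longrightarrow> p t \<ge> t powr n"
    and h: "\<And>t. t \<ge> R \<Longrightarrow> u t \<ge> 0 \<Longrightarrow> h t \<le> lam\<^sup>2 * t powr (n - 2) * u t"
    and "t \<ge> R"
  shows "u t > 0"
proof (rule ccontr)
  assume "\<not> u t > 0"
  have "lam > 0"
    using \<open>n > 1\<close> by (simp add: lam)
  have p_pos: "p s > 0" if "s \<ge> R" for s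
    using p[OF that] that \<open>R > 0\<close> powr_gt_zero[of s n] by linarith
  have cont_u: "continuous_on {R..} u" and cont_q: "continuous_on {R..} q"
    using u' q' by (auto intro!: DERIV_continuous_on)
  \<comment> \<open>Its least element \<open>m\<close> is the first point where \<open>u\<close> is
    not positive; before it \<open>u > 0\<close>, as the comparison requires.\<close>
  define S where "S = {R..t} \<inter> u -` {..0}"
  have "closed S"
    unfolding S_def by (intro continuous_closed_preimage continuous_on_subset[OF cont_u]) auto
  moreover have "t \<in> S"
    using \<open>\<not> u t > 0\<close> \<open>t \<ge> R\<close> by (simp add: S_def)
  moreover have "bounded S"
    unfolding S_def by (rule bounded_subset[OF bounded_closed_interval[of R t]]) auto
  ultimately obtain m where m: "m \<in> S" "\<And>s. s \<in> S \<Longrightarrow> m \<le> s"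
    using compact_attains_inf[of S] by (auto simp: compact_eq_bounded_closed)
  have "m \<ge> R" "u m \<le> 0"
    using m(1) by (auto simp: S_def)
  have u_pos: "u s > 0" if "R \<le> s" "s < m" for s
    using m(1) m(2)[of s] that by (force simp: S_def)
  define E where "E s = q s + lam * s powr (n - 1) * u s" for s
  have E_nonneg: "E s \<ge> 0" if s: "R \<le> s" "s < m" for s
  proof -
    \<comment> \<open>The integrating factor removes the term \<open>lam / x * E x\<close> of
      indefinite effect, leaving two brackets that can be signed separately.\<close>
    have "s powr (- lam) * E s \<ge> 0"
    proof (rule nonneg_barrier[OF s(1)])
      show "continuous_on {R..s} (\<lambda>s. s powr (- lam) * E s)"
        unfolding E_def using \<open>R > 0\<close>
        by (intro continuous_intros continuous_on_subset[OF cont_u] continuous_on_subset[OF cont_q]) auto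
      show "R powr (- lam) * E R \<ge> 0"
        using \<open>q R = 0\<close> \<open>u R > 0\<close> \<open>lam > 0\<close> by (simp add: E_def)
      fix x assume x: "R < x" "x < s" "x powr (- lam) * E x < 0"
      have "x > 0"
        using x \<open>R > 0\<close> by simp
      have "u x > 0"
        using u_pos[of x] x s by simp
      have "E x < 0"
        using x(3) \<open>x > 0\<close> by (simp add: mult_less_0_iff)
      moreover have "lam * x powr (n - 1) * u x \<ge> 0"
        using \<open>u x > 0\<close> \<open>lam > 0\<close> by simp
      ultimately have "q x < 0"
        unfolding E_def by linarith
      have du: "(u has_real_derivative q x / p x) (at x)" and dq: "(q has_real_derivative - h x) (at x)"
        using u'[of x] q'[of x] x(1) at_within_halfline[OF x(1)] by auto
      define A where "A = x powr (n - 2)"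
      have pw: "x powr (n - 1) = x * A" "x powr n = x\<^sup>2 * A"
        using \<open>x > 0\<close> powr_add[of x 1 "n - 2"] powr_add[of x 2 "n - 2"] by (auto simp: A_def)
      note powr' = has_real_derivative_powr[OF \<open>x > 0\<close>]
      have "(E has_real_derivative - h x + (lam * ((n - 1) * x powr (n - 1 - 1)) * u x +
          q x / p x * (lam * x powr (n - 1)))) (at x)"
        unfolding E_def by (intro DERIV_add DERIV_mult DERIV_cmult dq du powr')
      from DERIV_mult[OF powr' this, of "- lam"]
      have "((\<lambda>s. s powr (- lam) * E s) has_real_derivative
          x powr (- lam) * (- lam / x * E x +
            (- h x + lam * ((n - 1) * A * u x + x * A * (q x / p x))))) (at x)"
      proof (rule DERIV_cong)
        have "x powr (- lam - 1) = x powr (- lam) / x" "x powr (n - 1 - 1) = A"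
          using \<open>x > 0\<close> by (simp_all add: powr_diff A_def)
        then show "(- lam * x powr (- lam - 1)) * E x + (- h x + (lam * ((n - 1) * x powr (n - 1 - 1)) * u x +
            q x / p x * (lam * x powr (n - 1)))) * x powr (- lam) =
          x powr (- lam) * (- lam / x * E x + (- h x + lam * ((n - 1) * A * u x + x * A * (q x / p x))))"
          unfolding pw(1) by (simp add: algebra_simps)
      qed
      \<comment> \<open>Here \<open>n - 1 = 2 * lam\<close> is used: of the coefficient
        \<open>2 * lam\<^sup>2\<close> of \<open>A * u x\<close> one half is absorbed by the
        integrating factor, and the other half balances \<open>h\<close>.\<close>
      moreover have "- lam / x * E x + (- h x + lam * ((n - 1) * A * u x + x * A * (q x / p x))) =
          (lam\<^sup>2 * A * u x - h x) + lam / x * (x powr n * q x / p x - q x)"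
        using \<open>x > 0\<close> unfolding E_def pw lam by (simp add: field_simps power2_eq_square)
      \<comment> \<open>The inequality \<open>p \<ge> x powr n\<close> helps because
        \<open>q x\<close> is negative, which holds wherever \<open>E x < 0\<close> and
        \<open>u x > 0\<close>.\<close>
      moreover have "x powr n * q x / p x - q x \<ge> 0"
      proof -
        have "x powr n / p x \<le> 1"
          using p[of x] p_pos[of x] x(1) by simp
        from mult_right_mono_neg[OF this, of "q x"] \<open>q x < 0\<close> show ?thesis
          by simp
      qed
      moreover have "lam\<^sup>2 * A * u x - h x \<ge> 0"
        using h[of x] x(1) \<open>u x > 0\<close> by (simp add: A_def)
      ultimately show "\<exists>y\<ge>0. ((\<lambda>s. s powr (- lam) * E s) has_real_derivative y) (at x)"
        using \<open>lam > 0\<close> \<open>x > 0\<close>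
        by (metis (no_types, lifting) add_nonneg_nonneg divide_nonneg_nonneg less_imp_le mult_nonneg_nonneg powr_ge_zero)
    qed
    then show ?thesis
      using \<open>R > 0\<close> s by (simp add: zero_le_mult_iff)
  qed
  \<comment> \<open>Monotonicity up to \<open>m\<close> contradicts positivity at \<open>R\<close>
    together with nonpositivity at \<open>m\<close>.\<close>
  have "R powr lam * u R \<le> m powr lam * u m"
  proof (rule DERIV_nonneg_imp_increasing_open[OF \<open>m \<ge> R\<close>])
    show "continuous_on {R..m} (\<lambda>s. s powr lam * u s)"
      using \<open>R > 0\<close> by (intro continuous_intros continuous_on_subset[OF cont_u]) auto
    fix x assume x: "R < x" "x < m"
    have "x > 0" and "u x > 0"
      using x \<open>R > 0\<close> u_pos[of x] by auto
    have px: "p x > 0" "x powr n \<le> p x"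
      using p[of x] p_pos[of x] x by auto
    have "(u has_real_derivative q x / p x) (at x)"
      using u'[of x] x(1) at_within_halfline[OF x(1)] by auto
    then have "((\<lambda>s. s powr lam * u s) has_real_derivative x powr lam * (lam / x * u x + q x / p x)) (at x)"
      using \<open>x > 0\<close> by (auto intro!: derivative_eq_intros simp: powr_diff field_simps)
    moreover have "lam / x * u x + q x / p x \<ge> 0"
    proof (cases "q x \<ge> 0")
      case True
      then show ?thesis
        using \<open>lam > 0\<close> \<open>x > 0\<close> \<open>u x > 0\<close> px by (intro add_nonneg_nonneg) auto
    next
      case False
      have "- q x / p x \<le> - q x / x powr n"
        using px False \<open>x > 0\<close> by (intro divide_left_mono) auto
      also have "\<dots> \<le> lam * x powr (n - 1) * u x / x powr n"
        using E_nonneg[of x] x by (intro divide_right_mono) (auto simp: E_def)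
      also have "\<dots> = lam / x * u x"
        using \<open>x > 0\<close> by (simp add: powr_diff)
      finally show ?thesis
        by simp
    qed
    ultimately show "\<exists>y. ((\<lambda>s. s powr lam * u s) has_real_derivative y) (at x) \<and> 0 \<le> y"
      by (metis mult_nonneg_nonneg powr_ge_zero)
  qed
  moreover have "R powr lam * u R > 0"
    using \<open>R > 0\<close> \<open>u R > 0\<close> by simp
  moreover have "m powr lam * u m \<le> 0"
    using \<open>u m \<le> 0\<close> by (simp add: mult_nonneg_nonpos)
  ultimately show False
    by linarith
qed

text \<open>First \<open>q\<close> is bounded by \<open>Z\<close>, the integral of
  \<open>M * k * u\<close>. As \<open>Z\<close> increases, integrating \<open>q / p\<close> costs at
  most a factor \<open>P\<close>, so \<open>u\<close> is bounded by \<open>V\<close> with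
  \<open>V' = P * M * k * u \<le> P * M * k * V\<close>, and Gronwall's argument applies to
  \<open>V\<close>.\<close>

lemma gronwall_twice:
  fixes u q p h k :: "real \<Rightarrow> real"
  assumes u': "\<And>t. t \<ge> R \<Longrightarrow> (u has_real_derivative q t / p t) (at t within {R..})"
    and q': "\<And>t. t \<ge> R \<Longrightarrow> (q has_real_derivative - h t) (at t within {R..})"
    and "q R = 0"
    and p_cont: "continuous_on {R..} p" and p_pos: "\<And>t. t \<ge> R \<Longrightarrow> p t > 0"
    and p_int: "(\<lambda>t. 1 / p t) integrable_on {R..}"
    and k_cont: "continuous_on {R..} k" and k_nonneg: "\<And>t. t \<ge> R \<Longrightarrow> k t \<ge> 0"
    and k_int: "k integrable_on {R..}"
    and u_nonneg: "\<And>t. t \<ge> R \<Longrightarrow> u t \<ge> 0"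
    and h: "\<And>t. t \<ge> R \<Longrightarrow> - h t \<le> M * k t * u t" and "M \<ge> 0"
    and "t \<ge> R"
  shows "u t \<le> u R * exp (M * integral {R..} (\<lambda>t. 1 / p t) * integral {R..} k)"
proof -
  define P where "P = integral {R..} (\<lambda>t. 1 / p t)"
  have ip_cont: "continuous_on {R..} (\<lambda>t. 1 / p t)"
    using p_pos by (intro continuous_intros p_cont) (auto simp: less_imp_neq[symmetric])
  have P_ge: "integral {R..t} (\<lambda>t. 1 / p t) \<le> P" if "t \<ge> R" for t
    unfolding P_def using p_pos that p_int
    by (intro integral_subset_le integrable_continuous_real continuous_on_subset[OF ip_cont]) (auto simp: less_imp_le)
  have "P \<ge> 0"
    using P_ge[of R] by simp
  have cont_u: "continuous_on {R..} u"
    using u' by (auto intro!: DERIV_continuous_on)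
  define Z where "Z t = M * integral {R..t} (\<lambda>s. k s * u s)" for t
  have ku_cont: "continuous_on {R..} (\<lambda>s. k s * u s)"
    by (intro continuous_intros k_cont cont_u)
  have Z': "(Z has_real_derivative M * (k t * u t)) (at t within {R..})" if "t \<ge> R" for t
    unfolding Z_def by (intro DERIV_cmult integral_upper_halfline_derivative[OF ku_cont that])
  have Z_mono: "Z s \<le> Z t" if "R \<le> s" "s \<le> t" for s t
  proof (rule halfline_nondecreasing[OF _ _ that(2)])
    show "(Z has_real_derivative M * (k x * u x)) (at x within {s..})" if "x \<ge> s" for x
      using Z'[of x] that \<open>R \<le> s\<close> by (auto elim: has_field_derivative_subset)
    show "M * (k x * u x) \<ge> 0" if "s < x" "x < t" for x
      using that \<open>R \<le> s\<close> \<open>M \<ge> 0\<close> k_nonneg u_nonneg by auto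
  qed
  have q_le: "q t \<le> Z t" if "t \<ge> R" for t
  proof -
    have "Z R - q R \<le> Z t - q t"
    proof (rule halfline_nondecreasing[OF _ _ that])
      show "((\<lambda>t. Z t - q t) has_real_derivative M * (k x * u x) - - h x) (at x within {R..})" if "x \<ge> R" for x
        using Z'[OF that] q'[OF that] by (rule DERIV_diff)
      show "M * (k x * u x) - - h x \<ge> 0" if "R < x" for x
        using h[of x] that by (simp add: mult.assoc)
    qed
    then show ?thesis
      using \<open>q R = 0\<close> by (simp add: Z_def)
  qed
  define V where "V t = u R + P * Z t" for t
  have u_le: "u t \<le> V t" if t: "t \<ge> R" for t
  proof -
    \<comment> \<open>\<open>Z\<close> is frozen at the endpoint \<open>t\<close>, where it is
      largest, so that it leaves the integral of \<open>1 / p\<close> as a constant factor.\<close>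
    have "Z t * integral {R..R} (\<lambda>t. 1 / p t) - u R \<le> Z t * integral {R..t} (\<lambda>t. 1 / p t) - u t"
    proof (rule halfline_nondecreasing[OF _ _ t])
      show "((\<lambda>x. Z t * integral {R..x} (\<lambda>t. 1 / p t) - u x) has_real_derivative
          Z t * (1 / p x) - q x / p x) (at x within {R..})" if "x \<ge> R" for x
        by (intro DERIV_diff DERIV_cmult integral_upper_halfline_derivative[OF ip_cont that] u'[OF that])
      show "Z t * (1 / p x) - q x / p x \<ge> 0" if "R < x" "x < t" for x
        using q_le[of x] Z_mono[of x t] that p_pos[of x] by (simp add: divide_right_mono)
    qed
    then have "u t \<le> u R + Z t * integral {R..t} (\<lambda>t. 1 / p t)"
      by simp
    also have "\<dots> \<le> V t"
      using mult_left_mono[OF P_ge[OF t], of "Z t"] Z_mono[of R t] t by (simp add: V_def Z_def mult.commute)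
    finally show ?thesis .
  qed
  define B where "B t = P * M * integral {R..t} k" for t
  \<comment> \<open>With the integrating factor \<open>exp (- B)\<close>, the derivative of the
    weighted \<open>V\<close> is nonpositive because \<open>u \<le> V\<close>.\<close>
  have "- (V R * exp (- B R)) \<le> - (V t * exp (- B t))"
  proof (rule halfline_nondecreasing[OF _ _ \<open>t \<ge> R\<close>])
    fix x assume x: "x \<ge> R"
    have B': "(B has_real_derivative P * M * k x) (at x within {R..})"
      unfolding B_def by (intro DERIV_cmult integral_upper_halfline_derivative[OF k_cont x])
    have V': "(V has_real_derivative P * (M * (k x * u x))) (at x within {R..})"
      unfolding V_def using DERIV_add[OF DERIV_const DERIV_cmult[OF Z'[OF x]]] by simp
    show "((\<lambda>t. - (V t * exp (- B t))) has_real_derivative P * M * k x * exp (- B x) * (V x - u x)) (at x within {R..})"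
      by (rule derivative_eq_intros B' V' refl)+ (simp add: algebra_simps)
  next
    fix x assume "R < x"
    then show "P * M * k x * exp (- B x) * (V x - u x) \<ge> 0"
      using u_le[of x] k_nonneg[of x] \<open>M \<ge> 0\<close> \<open>P \<ge> 0\<close> by simp
  qed
  then have "V t * exp (- B t) \<le> u R"
    by (simp add: V_def Z_def B_def)
  then have "V t \<le> u R * exp (B t)"
    by (simp add: exp_minus field_simps)
  also have "\<dots> \<le> u R * exp (M * P * integral {R..} k)"
  proof -
    have "integral {R..t} k \<le> integral {R..} k"
      using k_nonneg k_int \<open>t \<ge> R\<close>
      by (intro integral_subset_le integrable_continuous_real continuous_on_subset[OF k_cont]) auto
    from mult_left_mono[OF this, of "P * M"] show ?thesis
      using \<open>M \<ge> 0\<close> \<open>P \<ge> 0\<close> u_nonneg[of R] by (intro mult_left_mono) (auto simp: B_def mult_ac)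
  qed
  finally show ?thesis
    using u_le[OF \<open>t \<ge> R\<close>] by (simp add: P_def)
qed

section \<open>Linear bounds from the comparison functions\<close>

text \<open>Near 0 the finite upper limit bounds the quotient; away from 0, monotonicity bounds the
  numerator by \<open>F d\<close> while the denominator stays above \<open>\<delta>\<close>. This
  makes the supremum in \<open>M_sup\<close> a genuine one.\<close>

lemma comparison_fun_bdd:
  assumes "comparison_fun F"
  shows "bdd_above ((\<lambda>v. F v / v) ` {0<..d})"
proof -
  have mono: "mono_on {0..} F" and nonneg: "\<And>v. v \<ge> 0 \<Longrightarrow> F v \<ge> 0"
    and lim: "Limsup (at_right 0) (\<lambda>v. ereal (F v / v)) < \<infinity>"
    using assms by (auto simp: comparison_fun_def)
  obtain C where "Limsup (at_right 0) (\<lambda>v. ereal (F v / v)) < ereal C"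
    using ereal_dense2[OF lim] by blast
  then have "\<forall>\<^sub>F v in at_right 0. F v / v < C"
    using Limsup_lessD by fastforce
  then obtain \<delta> where \<delta>: "\<delta> > 0" "\<And>v. 0 < v \<Longrightarrow> v < \<delta> \<Longrightarrow> F v / v < C"
    by (auto simp: eventually_at_right_field)
  show ?thesis
  proof (rule bdd_aboveI2)
    fix v assume v: "v \<in> {0<..d}"
    show "F v / v \<le> max C (F d / \<delta>)"
    proof (cases "v < \<delta>")
      case True
      then show ?thesis
        using \<delta>(2)[of v] v by simp
    next
      case False
      have "F v \<le> F d"
        using mono v by (intro mono_onD[of "{0..}" F]) auto
      then have "F v / v \<le> F d / \<delta>"
        using False \<delta>(1) v nonneg by (intro frac_le) auto
      then show ?thesis
        by simp
    qed
  qed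
qed

lemma comparison_fun_le:
  assumes "comparison_fun F" "0 \<le> v" "v \<le> d"
  shows "F v \<le> M_sup F d * v"
proof (cases "v = 0")
  case True
  then show ?thesis
    using assms by (simp add: comparison_fun_def)
next
  case False
  then have "F v / v \<le> M_sup F d"
    unfolding M_sup_def using assms comparison_fun_bdd[OF assms(1)] by (intro cSUP_upper) auto
  then show ?thesis
    using False assms(2) by (simp add: pos_divide_le_eq)
qed

lemma M_sup_pos:
  assumes "comparison_fun F" "d > 0"
  shows "M_sup F d > 0"
proof -
  have "0 < F d"
    using assms by (simp add: comparison_fun_def)
  also have "\<dots> \<le> M_sup F d * d"
    using assms by (intro comparison_fun_le) auto
  finally show ?thesis
    using assms(2) by (simp add: zero_less_mult_iff)
qed

section \<open>Assembly of a solution on the half-line\<close>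

context halfline_problem
begin

lemma solution_exists:
  fixes b1 b2 F1 F2 :: "real \<Rightarrow> real"
  assumes p_int: "(\<lambda>t. 1 / p t) integrable_on {R..}"
    and b1_cont: "continuous_on {R..} b1" and b2_nonneg: "\<And>t. t \<ge> R \<Longrightarrow> b2 t \<ge> 0"
    and F: "comparison_fun F1" "comparison_fun F2"
    and f_bounds: "\<And>t v. t \<ge> R \<Longrightarrow> v \<ge> 0 \<Longrightarrow> b1 t * F1 v \<le> f t v \<and> f t v \<le> b2 t * F2 v"
    and b1_int: "(\<lambda>t. max 0 (- b1 t)) integrable_on {R..}"
    and \<rho>: "0 < \<rho>1" "\<rho>1 < \<rho>2"
    and I: "(cond_I0 \<alpha> \<beta> p R a b f H \<rho>1 \<and> cond_I1 \<alpha> \<beta> p R a b f H \<rho>2) \<or>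
      (cond_I1 \<alpha> \<beta> p R a b f H \<rho>1 \<and> cond_I0 \<alpha> \<beta> p R a b f H \<rho>2)"
    and star: "\<exists>n>1. cond_star p R b1 b2 F1 F2 n (2 * \<rho>2)"
  obtains u where "is_solution \<alpha> \<beta> p R a b f H u" "\<forall>t\<ge>0. u t \<le> 2 * \<rho>2" "\<rho>1 < u R" "u R < \<rho>2"
proof -
  define d where "d = 2 * \<rho>2"
  have d: "d > 0" "d \<ge> 0" "\<rho>2 \<le> d"
    using \<rho> by (auto simp: d_def)
  obtain n where "n > 1" and B1: "B1_minus b1 R \<le> ln 2 / (M_sup F1 d * P_tail p R)"
    and pn: "\<And>t. t \<ge> R \<Longrightarrow> p t \<ge> t powr n"
    and b2: "\<And>t. t \<ge> R \<Longrightarrow> b2 t \<le> (n - 1)\<^sup>2 / (4 * M_sup F2 d) * t powr (n - 2)"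
    using star by (auto simp: cond_star_def d_def)
  obtain v where v: "v \<in> K" "\<rho>1 < norm v" "norm v < \<rho>2" "T d v = v"
    by (rule fixed_point_exists[OF \<rho> d(3) I]) (rule that; assumption)
  let ?v = "apply_bcontfun v"
  define q0 where "q0 = integral {0..R} (\<lambda>s. ftrunc d s (?v s))"
  note vv = fixed_point_volterra[OF d(2) v(1,4), folded q0_def]
  interpret V: volterra_equation p "ftrunc d" "?v 0" q0
    by (rule ftrunc_volterra[OF d(2)])
  obtain u where u: "continuous_on {0..} u" "\<And>t. t \<in> {0..R} \<Longrightarrow> u t = ?v t"
    "\<And>t. t \<ge> 0 \<Longrightarrow> u t = volterra p (ftrunc d) (?v 0) q0 u t"
  proof (rule V.volterra_extend_halfline[of R ?v])
    show "0 \<le> R"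
      using R_pos by simp
    show "continuous_on {0..R} ?v"
      by simp
    show "?v t = volterra p (ftrunc d) (?v 0) q0 ?v t" if "t \<in> {0..R}" for t
      by (rule vv(1)[OF that])
  qed (rule that)
  define q where "q = momentum (ftrunc d) q0 u"
  define h where "h t = ftrunc d t (u t)" for t
  have du: "(u has_real_derivative q t / p t) (at t within {0..})"
    and dq: "(q has_real_derivative - ftrunc d t (u t)) (at t within {0..})" if "t \<ge> 0" for t
    unfolding q_def by (rule V.volterra_derivatives[OF u(1) _ that], erule u(3))+
  have u'_cont: "continuous_on {0..} (\<lambda>t. q t / p t)"
    unfolding q_def by (rule V.volterra_derivatives(3)[OF u(1) _ order_refl]) (erule u(3))
  have u': "(u has_real_derivative q t / p t) (at t within {R..})"
    and q': "(q has_real_derivative - h t) (at t within {R..})" if "t \<ge> R" for t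
    using du[of t] dq[of t] that R_pos unfolding h_def by (auto elim: has_field_derivative_subset)
  \<comment> \<open>Since \<open>u\<close> agrees with the fixed point on \<open>{0..R}\<close>, the
    integral is the very number \<open>q0\<close>; both comparison arguments start from this
    vanishing momentum.\<close>
  have "q R = q0 - integral {0..R} (\<lambda>s. ftrunc d s (u s))"
    by (simp add: q_def momentum_def)
  also have "integral {0..R} (\<lambda>s. ftrunc d s (u s)) = q0"
    unfolding q0_def by (rule integral_cong) (simp add: u(2))
  finally have qR: "q R = 0"
    by simp
  have uR: "u R = norm v"
    using u(2)[of R] vv(3) R_pos by simp
  have clip: "0 \<le> max 0 (min d x)" "max 0 (min d x) \<le> d" for x
    using d by auto
  have u_pos: "u t > 0" if "t \<ge> R" for t
  \<comment> \<open>The comparison applies to the truncated equation, because for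
    \<open>u t \<ge> 0\<close> the clamped argument is at most \<open>u t\<close> and lies in the
    range of the linear bound for \<open>F2\<close>.\<close>
  proof (rule euler_comparison_pos[OF R_pos \<open>n > 1\<close> refl u' q' qR _ pn _ that])
    show "u R > 0"
      using uR v(2) \<rho> by linarith
    fix t assume t: "t \<ge> R" "u t \<ge> 0"
    have "h t \<le> b2 t * F2 (max 0 (min d (u t)))"
      using f_bounds[OF t(1) clip(1)] by (simp add: h_def ftrunc_def)
    also have "\<dots> \<le> b2 t * (M_sup F2 d * max 0 (min d (u t)))"
      using b2_nonneg[OF t(1)] clip by (intro mult_left_mono comparison_fun_le F)
    also have "\<dots> \<le> b2 t * (M_sup F2 d * u t)"
      using b2_nonneg[OF t(1)] M_sup_pos[OF F(2) d(1)] t(2) d by (intro mult_left_mono) auto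
    also have "\<dots> = (b2 t * M_sup F2 d) * u t"
      by simp
    also have "\<dots> \<le> ((n - 1)\<^sup>2 / (4 * M_sup F2 d) * t powr (n - 2) * M_sup F2 d) * u t"
      using b2[OF t(1)] M_sup_pos[OF F(2) d(1)] t(2) by (intro mult_right_mono) auto
    also have "\<dots> = ((n - 1) / 2)\<^sup>2 * t powr (n - 2) * u t"
      using M_sup_pos[OF F(2) d(1)] by (simp add: power_divide)
    finally show "h t \<le> ((n - 1) / 2)\<^sup>2 * t powr (n - 2) * u t" .
  qed auto
  define M P where "M = M_sup F1 d" and "P = P_tail p R"
  have M: "M > 0"
    unfolding M_def by (rule M_sup_pos[OF F(1) d(1)])
  have "P \<ge> 0"
    unfolding P_def P_tail_def using p_pos R_pos
    by (intro integral_nonneg p_int) (auto simp: less_imp_le)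
  \<comment> \<open>\<open>P\<close> is known here only to be nonnegative, so the division in the
    hypothesis on \<open>B1_minus\<close> is cleared separately for \<open>P = 0\<close>.\<close>
  have B1_small: "M * P * B1_minus b1 R \<le> ln 2"
  proof (cases "P = 0")
    case False
    then have "M * P > 0"
      using M \<open>P \<ge> 0\<close> by simp
    then show ?thesis
      using B1 by (simp add: M_def P_def pos_le_divide_eq mult.commute)
  qed simp
  have u_le: "u t \<le> 2 * \<rho>2" if "t \<ge> R" for t
  proof -
    have "u t \<le> u R * exp (M * integral {R..} (\<lambda>t. 1 / p t) * integral {R..} (\<lambda>t. max 0 (- b1 t)))"
    proof (rule gronwall_twice[OF u' q' qR _ _ p_int _ _ b1_int _ _ _ that])
      show "- h t \<le> M * max 0 (- b1 t) * u t" if t: "t \<ge> R" for t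
      proof -
        let ?x = "max 0 (min d (u t))"
        have "- h t \<le> - b1 t * F1 ?x"
          using f_bounds[OF t clip(1)] by (simp add: h_def ftrunc_def)
        also have "\<dots> \<le> max 0 (- b1 t) * F1 ?x"
          using F(1) by (intro mult_right_mono) (auto simp: comparison_fun_def)
        also have "\<dots> \<le> max 0 (- b1 t) * (M * ?x)"
          unfolding M_def using clip by (intro mult_left_mono comparison_fun_le F) auto
        also have "\<dots> \<le> max 0 (- b1 t) * (M * u t)"
          using u_pos[OF t] M by (intro mult_left_mono) auto
        finally show ?thesis
          by (simp add: mult_ac)
      qed
    qed (use R_pos p_pos M u_pos in \<open>auto simp: less_imp_le intro!: continuous_intros b1_cont continuous_on_subset[OF p_cont]\<close>)
    also have "\<dots> \<le> u R * exp (ln 2)"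
      using B1_small u_pos[of R] unfolding P_def P_tail_def B1_minus_def
      by (intro mult_left_mono exp_le_cancel_iff[THEN iffD2]) auto
    also have "\<dots> \<le> 2 * \<rho>2"
      using uR v(3) by simp
    finally show ?thesis .
  qed
  have u_range: "0 \<le> u t \<and> u t \<le> 2 * \<rho>2" if "t \<ge> 0" for t
  proof (cases "t \<le> R")
    case True
    then show ?thesis
      using u(2)[of t] K_nonneg[OF v(1), of t] norm_bounded[of v t] v(3) \<rho> that by auto
  next
    case False
    then show ?thesis
      using u_le[of t] u_pos[of t] by simp
  qed
  \<comment> \<open>The bounds place \<open>u\<close> in \<open>{0..d}\<close> on the whole
    half-line, so the truncated equation is the original one.\<close>
  have h_eq: "ftrunc d t (u t) = f t (u t)" if "t \<ge> 0" for t
    using u_range[OF that] by (simp add: ftrunc_def d_def)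
  have restrict_u: "restrict u {0..R} = J v"
    unfolding J_def by (rule restrict_ext) (simp add: u(2))
  have C1_u: "C1_halfline u (\<lambda>t. q t / p t)"
    unfolding C1_halfline_def using du u'_cont by blast
  have "((\<lambda>t. p t * (q t / p t)) has_real_derivative - f t (u t)) (at t within {0..})" if "t \<ge> 0" for t
  proof (rule has_field_derivative_transform_within[where d=1 and f=q])
    show "(q has_real_derivative - f t (u t)) (at t within {0..})"
      using dq[OF that] by (simp add: h_eq[OF that])
  qed (use that p_nonzero in auto)
  moreover have "continuous_on {0..} (\<lambda>t. - f t (u t))"
  proof -
    have "continuous_on {0..} (\<lambda>t. - ftrunc d t (u t))"
      by (intro continuous_intros V.g_comp_cont u(1)) simp
    then show ?thesis
      by (rule continuous_on_eq) (simp add: h_eq)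
  qed
  ultimately have C1_pu: "C1_halfline (\<lambda>t. p t * (q t / p t)) (\<lambda>t. - f t (u t))"
    unfolding C1_halfline_def by blast
  have "q 0 = q0" "u 0 = ?v 0"
    using u(2)[of 0] R_pos by (auto simp: q_def momentum_def)
  then have bc: "\<alpha> * u 0 - \<beta> * (q 0 / p 0) = functional_B R H u"
    using vv(2) by (simp add: functional_B_def restrict_u)
  have "bounded (u ` {0..})"
    unfolding bounded_iff using u_range by (intro exI[of _ "2 * \<rho>2"]) auto
  moreover have "\<exists>u' w. C1_halfline u u' \<and> C1_halfline (\<lambda>t. p t * u' t) w \<and>
      (\<forall>t\<ge>0. w t + f t (u t) = 0) \<and> \<alpha> * u 0 - \<beta> * u' 0 = functional_B R H u"
    by (rule exI[of _ "\<lambda>t. q t / p t"], rule exI[of _ "\<lambda>t. - f t (u t)"])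
      (intro conjI C1_u C1_pu bc allI impI, simp)
  ultimately have "is_solution \<alpha> \<beta> p R a b f H u"
    unfolding is_solution_def restrict_u using u_range J_in_cone[OF v(1)] by blast
  then show ?thesis
    using that[of u] u_range uR v by simp
qed

end

text \<open>\<open>u1\<close> is chosen before \<open>\<rho>3\<close> is quantified, so one first
  solution serves every \<open>\<rho>3\<close>. Distinctness is asserted at some
  \<open>t \<ge> 0\<close>, since values at negative times carry no meaning.\<close>

theorem theorem4p1:
  fixes R \<alpha> \<beta> a b :: real
    and p :: "real \<Rightarrow> real"
    and f :: "real \<Rightarrow> real \<Rightarrow> real"
    and b1 b2 F1 F2 :: "real \<Rightarrow> real"
    and H :: "(real \<Rightarrow> real) \<Rightarrow> real"
    and \<rho>1 \<rho>2 :: real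
  assumes "R > 0" and "\<alpha> > 0" and "\<beta> \<ge> 0"
    and "0 \<le> a" and "a < b" and "b \<le> R" and "\<beta> = 0 \<Longrightarrow> a > 0"
    and "continuous_on {0..} p" and "\<And>t. t \<ge> 0 \<Longrightarrow> p t > 0"
    and "(\<lambda>t. 1 / p t) integrable_on {R..}"
    and "continuous_on ({0..} \<times> {0..}) (\<lambda>(t, v). f t v)"
    and "\<And>t v. t \<in> {0..R} \<Longrightarrow> v \<ge> 0 \<Longrightarrow> f t v \<ge> 0"
    and "\<And>t. t \<ge> 0 \<Longrightarrow> f t 0 = 0"
    and "continuous_on {R..} b1" and "continuous_on {R..} b2"
    and "\<And>t. t \<ge> R \<Longrightarrow> b2 t \<ge> 0"
    and "comparison_fun F1" and "comparison_fun F2"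
    and "\<And>t v. t \<ge> R \<Longrightarrow> v \<ge> 0 \<Longrightarrow> b1 t * F1 v \<le> f t v \<and> f t v \<le> b2 t * F2 v"
    and "(\<lambda>t. max 0 (- b1 t)) integrable_on {R..}"
    and "admissible_H \<alpha> \<beta> p R a b H"
    and "0 < \<rho>1" and "\<rho>1 < \<rho>2"
    and "(cond_I0 \<alpha> \<beta> p R a b f H \<rho>1 \<and> cond_I1 \<alpha> \<beta> p R a b f H \<rho>2) \<or>
         (cond_I1 \<alpha> \<beta> p R a b f H \<rho>1 \<and> cond_I0 \<alpha> \<beta> p R a b f H \<rho>2)"
    and "\<exists>n>1. cond_star p R b1 b2 F1 F2 n (2 * \<rho>2)"
  shows "\<exists>u1. is_solution \<alpha> \<beta> p R a b f H u1 \<and> (\<forall>t\<ge>0. u1 t \<le> 2 * \<rho>2) \<and>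
    (\<forall>\<rho>3>\<rho>2.
       ((cond_I0 \<alpha> \<beta> p R a b f H \<rho>1 \<and> cond_I1 \<alpha> \<beta> p R a b f H \<rho>2 \<and>
           cond_I0 \<alpha> \<beta> p R a b f H \<rho>3) \<or>
        (cond_I1 \<alpha> \<beta> p R a b f H \<rho>1 \<and> cond_I0 \<alpha> \<beta> p R a b f H \<rho>2 \<and>
           cond_I1 \<alpha> \<beta> p R a b f H \<rho>3)) \<and>
       (\<exists>n>1. cond_star p R b1 b2 F1 F2 n (2 * \<rho>3)) \<longrightarrow>
       (\<exists>u2. is_solution \<alpha> \<beta> p R a b f H u2 \<and> (\<forall>t\<ge>0. u2 t \<le> 2 * \<rho>3) \<and>
             (\<exists>t\<ge>0. u2 t \<noteq> u1 t)))"
proof -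
  interpret halfline_problem R \<alpha> \<beta> a b p f H
    using assms(1-9,11,12,21) by unfold_locales auto
  have exists: "\<exists>u. is_solution \<alpha> \<beta> p R a b f H u \<and> (\<forall>t\<ge>0. u t \<le> 2 * s) \<and> r < u R \<and> u R < s"
    if "0 < r" "r < s" "(cond_I0 \<alpha> \<beta> p R a b f H r \<and> cond_I1 \<alpha> \<beta> p R a b f H s) \<or>
      (cond_I1 \<alpha> \<beta> p R a b f H r \<and> cond_I0 \<alpha> \<beta> p R a b f H s)"
      "\<exists>n>1. cond_star p R b1 b2 F1 F2 n (2 * s)" for r s
    by (rule solution_exists[OF assms(10,14) _ assms(17,18) _ assms(20) that]) (use assms(16,19) in blast)+
  obtain u1 where u1: "is_solution \<alpha> \<beta> p R a b f H u1" "\<forall>t\<ge>0. u1 t \<le> 2 * \<rho>2" "u1 R < \<rho>2"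
    using exists[OF assms(22-25)] by blast
  show ?thesis
  proof (rule exI[of _ u1], intro conjI allI impI)
    fix \<rho>3 assume "\<rho>3 > \<rho>2"
      and *: "((cond_I0 \<alpha> \<beta> p R a b f H \<rho>1 \<and> cond_I1 \<alpha> \<beta> p R a b f H \<rho>2 \<and>
           cond_I0 \<alpha> \<beta> p R a b f H \<rho>3) \<or>
        (cond_I1 \<alpha> \<beta> p R a b f H \<rho>1 \<and> cond_I0 \<alpha> \<beta> p R a b f H \<rho>2 \<and>
           cond_I1 \<alpha> \<beta> p R a b f H \<rho>3)) \<and>
       (\<exists>n>1. cond_star p R b1 b2 F1 F2 n (2 * \<rho>3))"
    \<comment> \<open>The conditions alternate along the three radii, so the outer pair again has
      the form required of consecutive radii.\<close>
    then have I: "(cond_I0 \<alpha> \<beta> p R a b f H \<rho>2 \<and> cond_I1 \<alpha> \<beta> p R a b f H \<rho>3) \<or>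
      (cond_I1 \<alpha> \<beta> p R a b f H \<rho>2 \<and> cond_I0 \<alpha> \<beta> p R a b f H \<rho>3)"
      by blast
    have "0 < \<rho>2"
      using assms(22,23) by simp
    then obtain u2 where u2: "is_solution \<alpha> \<beta> p R a b f H u2" "\<forall>t\<ge>0. u2 t \<le> 2 * \<rho>3" "\<rho>2 < u2 R"
      using exists[OF _ \<open>\<rho>3 > \<rho>2\<close> I] * by blast
    have "u2 R \<noteq> u1 R"
      using u1(3) u2(3) by simp
    then show "\<exists>u2. is_solution \<alpha> \<beta> p R a b f H u2 \<and> (\<forall>t\<ge>0. u2 t \<le> 2 * \<rho>3) \<and> (\<exists>t\<ge>0. u2 t \<noteq> u1 t)"
      using u2 assms(1) by (intro exI[of _ u2] conjI exI[of _ R]) auto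
  qed (use u1 in auto)
qed

end
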